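(* Let $P,Q$ be orthogonal projections on a real or complex Hilbert space $\mathcal H$, and let $\mathcal H=M_{00}\oplus M_{01}\oplus M_{10}\oplus M_{11}\oplus M\oplus M$ be the Halmos decomposition for the pair $(P,Q)$ with associated selfadjoint operator $H$ on $M$ (see context). Let $A$ be the operator given by $$A=a_{00}I_{M_{00}}\oplus a_{01}I_{M_{01}}\oplus a_{10}I_{M_{10}}\oplus a_{11}I_{M_{11}}\oplus\begin{bmatrix}\phi_{00}(H)&\phi_{01}(H)\\ \phi_{10}(H)&\phi_{11}(H)\end{bmatrix},$$ where $a_{ij}$ are complex numbers and $\phi_{ij}$ are functions in $L^\infty(\sigma(H))$ with respect to the spectral measure of $H$. Put $\Lambda=\{(i,j):\dim M_{ij}\neq0\}$, $\phi=\sum_{i,j=0,1}|\phi_{ij}|^2$, $\omega=\phi_{00}\phi_{11}-\phi_{01}\phi_{10}$, $$\psi(x)=\phi(x)+\sqrt{\phi(x)^2-4|\omega(x)|^2},\qquad \lambda_{\max}=\max_{x\in\sigma(H)}\frac{\phi(x)+\sqrt{\phi(x)^2-4|\omega(x)|^2}}{2},$$ and let $\Sigma(A)$ be the set of $x\in\sigma(H)$ on which $\psi$ attains its maximum value. Then $A$ is norm attaining (that is, there exists a unit vector $v\in\mathcal H$ with $\|Av\|=\|A\|$) if and only if either (i) $\max_{(j,k)\in\Lambda}|a_{jk}|\ge\sqrt{\lambda_{\max}}$, or (ii) $\max_{(j,k)\in\Lambda}|a_{jk}|<\sqrt{\lambda_{\max}}$ and the spectral measure of $\Sigma(A)$ is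 non-zero.
   Context: Halmos' two projections theorem: for orthogonal projections $P,Q$ on a real or complex Hilbert space $\mathcal H$ there is a representation of $\mathcal H$ as an orthogonal sum $\mathcal H=M_{00}\oplus M_{01}\oplus M_{10}\oplus M_{11}\oplus M\oplus M$ (the last two summands have the same dimension and are identified via an appropriate unitary similarity) with respect to which $$P=I\oplus I\oplus0\oplus0\oplus\begin{bmatrix}I&0\\0&0\end{bmatrix},\qquad Q=I\oplus0\oplus I\oplus0\oplus\begin{bmatrix}I-H&\sqrt{H(I-H)}\\ \sqrt{H(I-H)}&H\end{bmatrix},$$ where $H$ is a selfadjoint operator on $M$ with spectrum $\sigma(H)\subseteq[0,1]$ and $0,1$ are not eigenvalues of $H$. Any of the subspaces $M_{ij}$ may or may not be actually present, and $M=\{0\}$ if and only if $P$ and $Q$ commute. "Spectral measure" means the spectral measure of $H$. By the Giles–Kummer theorem, the von Neumann algebra generated by $P$ and $Q$ consists of the operators $A$ of the stated form. The inequality $\phi(x)^2-4|\omega(x)|^2\ge0$ always holds, and $\lambda_{\max}$ is the right endpoint of the spectrum of $\Phi^*\Phi$, where $\Phi$ denotes the $2\times2$ block operator on $M\oplus M$ in the formula for $A$. *)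

theory Defs
  imports "HOL-Analysis.Analysis"
begin

text \<open>
  Real and complex Hilbert spaces are treated simultaneously. The scalars are the complex numbers
  in \<open>scalars\<close>, which is either \<open>\<real>\<close> or all of \<open>\<complex>\<close>, and \<open>scaleK c\<close> is only meaningful for \<open>c\<close> in that
  set. The norm, topology and completeness are those of the underlying real Hilbert space, and
  \<open>kinner\<close> is linear in the first argument.
\<close>

class hilbert = real_inner + complete_space +
  fixes scalars :: "'a itself \<Rightarrow> complex set"
    and scaleK :: "complex \<Rightarrow> 'a \<Rightarrow> 'a"
    and kinner :: "'a \<Rightarrow> 'a \<Rightarrow> complex"
  assumes scalars_cases: "scalars TYPE('a) = \<real> \<or> scalars TYPE('a) = UNIV"
    and scaleK_add_right: "c \<in> scalars TYPE('a) \<Longrightarrow> scaleK c (x + y) = scaleK c x + scaleK c y"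
    and scaleK_add_left: "c \<in> scalars TYPE('a) \<Longrightarrow> d \<in> scalars TYPE('a) \<Longrightarrow>
      scaleK (c + d) x = scaleK c x + scaleK d x"
    and scaleK_scaleK: "c \<in> scalars TYPE('a) \<Longrightarrow> d \<in> scalars TYPE('a) \<Longrightarrow>
      scaleK c (scaleK d x) = scaleK (c * d) x"
    and scaleK_of_real: "scaleK (of_real r) x = r *\<^sub>R x"
    and kinner_in_scalars: "kinner x y \<in> scalars TYPE('a)"
    and kinner_add_left: "kinner (x + y) z = kinner x z + kinner y z"
    and kinner_scaleK_left: "c \<in> scalars TYPE('a) \<Longrightarrow> kinner (scaleK c x) y = c * kinner x y"
    and kinner_commute: "kinner y x = cnj (kinner x y)"
    and kinner_self: "kinner x x = of_real ((norm x)\<^sup>2)"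


subsection \<open>Operators on closed subspaces\<close>

text \<open>An operator on a closed subspace \<open>V\<close> is a function whose values outside \<open>V\<close> are irrelevant.\<close>

definition closed_subspace :: "'a::hilbert set \<Rightarrow> bool" where
  "closed_subspace V \<longleftrightarrow> 0 \<in> V \<and> (\<forall>x\<in>V. \<forall>y\<in>V. x + y \<in> V) \<and>
     (\<forall>c\<in>scalars TYPE('a). \<forall>x\<in>V. scaleK c x \<in> V) \<and> closed V"

definition orthogonal_sets :: "'a::hilbert set \<Rightarrow> 'a set \<Rightarrow> bool" where
  "orthogonal_sets V W \<longleftrightarrow> (\<forall>x\<in>V. \<forall>y\<in>W. kinner x y = 0)"

definition linear_between :: "'a::hilbert set \<Rightarrow> 'a set \<Rightarrow> ('a \<Rightarrow> 'a) \<Rightarrow> bool" where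
  "linear_between V W T \<longleftrightarrow> (\<forall>x\<in>V. T x \<in> W) \<and> (\<forall>x\<in>V. \<forall>y\<in>V. T (x + y) = T x + T y) \<and>
     (\<forall>c\<in>scalars TYPE('a). \<forall>x\<in>V. T (scaleK c x) = scaleK c (T x))"

definition unitary_between :: "'a::hilbert set \<Rightarrow> 'a set \<Rightarrow> ('a \<Rightarrow> 'a) \<Rightarrow> bool" where
  "unitary_between V W U \<longleftrightarrow> linear_between V W U \<and> U ` V = W \<and>
     (\<forall>x\<in>V. \<forall>y\<in>V. kinner (U x) (U y) = kinner x y)"

definition bounded_operator :: "'a::hilbert set \<Rightarrow> ('a \<Rightarrow> 'a) \<Rightarrow> bool" where
  "bounded_operator V T \<longleftrightarrow> linear_between V V T \<and> (\<exists>B. \<forall>x\<in>V. norm (T x) \<le> B * norm x)"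

definition selfadjoint :: "'a::hilbert set \<Rightarrow> ('a \<Rightarrow> 'a) \<Rightarrow> bool" where
  "selfadjoint V T \<longleftrightarrow> bounded_operator V T \<and> (\<forall>x\<in>V. \<forall>y\<in>V. kinner (T x) y = kinner x (T y))"

definition positive_operator :: "'a::hilbert set \<Rightarrow> ('a \<Rightarrow> 'a) \<Rightarrow> bool" where
  "positive_operator V T \<longleftrightarrow> selfadjoint V T \<and> (\<forall>x\<in>V. 0 \<le> Re (kinner (T x) x))"

definition positive_sqrt :: "'a::hilbert set \<Rightarrow> ('a \<Rightarrow> 'a) \<Rightarrow> ('a \<Rightarrow> 'a) \<Rightarrow> bool" where
  "positive_sqrt V T S \<longleftrightarrow> positive_operator V S \<and> (\<forall>x\<in>V. S (S x) = T x)"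

definition orthogonal_projection :: "'a::hilbert set \<Rightarrow> ('a \<Rightarrow> 'a) \<Rightarrow> bool" where
  "orthogonal_projection V T \<longleftrightarrow> selfadjoint V T \<and> (\<forall>x\<in>V. T (T x) = T x)"

definition spectrum :: "'a::hilbert set \<Rightarrow> ('a \<Rightarrow> 'a) \<Rightarrow> complex set" where
  "spectrum V T = {c \<in> scalars TYPE('a). \<not> (\<exists>R. bounded_operator V R \<and>
     (\<forall>x\<in>V. R (T x - scaleK c x) = x \<and> T (R x) - scaleK c (R x) = x))}"

definition eigenvalue :: "'a::hilbert set \<Rightarrow> ('a \<Rightarrow> 'a) \<Rightarrow> complex \<Rightarrow> bool" where
  "eigenvalue V T c \<longleftrightarrow> c \<in> scalars TYPE('a) \<and> (\<exists>x\<in>V. x \<noteq> 0 \<and> T x = scaleK c x)"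

definition norm_attaining :: "('a::hilbert \<Rightarrow> 'a) \<Rightarrow> bool" where
  "norm_attaining T \<longleftrightarrow> (\<exists>v. norm v = 1 \<and> norm (T v) = onorm T)"


subsection \<open>Spectral measures and functional calculus\<close>

text \<open>
  In this section \<open>N\<close> only serves as a measurable space (its measure is irrelevant), and \<open>E\<close> is a
  projection-valued measure on \<open>N\<close> whose values are projections on \<open>V\<close>.
\<close>

definition projection_valued_measure ::
  "'a::hilbert set \<Rightarrow> real measure \<Rightarrow> (real set \<Rightarrow> 'a \<Rightarrow> 'a) \<Rightarrow> bool" where
  "projection_valued_measure V N E \<longleftrightarrow>
     (\<forall>S\<in>sets N. orthogonal_projection V (E S)) \<and>
     (\<forall>x\<in>V. E (space N) x = x) \<and>
     (\<forall>S\<in>sets N. \<forall>T\<in>sets N. \<forall>x\<in>V. E (S \<inter> T) x = E S (E T x)) \<and>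
     (\<forall>F::nat \<Rightarrow> real set. range F \<subseteq> sets N \<longrightarrow> disjoint_family F \<longrightarrow>
        (\<forall>x\<in>V. (\<lambda>n. E (F n) x) sums E (\<Union>n. F n) x))"

definition spectral_null :: "'a::hilbert set \<Rightarrow> (real set \<Rightarrow> 'a \<Rightarrow> 'a) \<Rightarrow> real set \<Rightarrow> bool" where
  "spectral_null V E S \<longleftrightarrow> (\<forall>x\<in>V. E S x = 0)"

text \<open>Representatives of the elements of \<open>L\<^sup>\<infinity>\<close>; they take values in the scalar field.\<close>

definition L_infinity ::
  "'a::hilbert set \<Rightarrow> real measure \<Rightarrow> (real set \<Rightarrow> 'a \<Rightarrow> 'a) \<Rightarrow> (real \<Rightarrow> complex) set" where
  "L_infinity V N E = {f \<in> borel_measurable N. f ` space N \<subseteq> scalars TYPE('a) \<and>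
     (\<exists>C. spectral_null V E {t \<in> space N. C < norm (f t)})}"

text \<open>
  Essential supremum of a nonnegative function; the restriction to \<open>0 \<le> c\<close> only matters when
  \<open>V = {0}\<close>, where the essential supremum is thereby taken to be \<open>0\<close>.
\<close>

definition ess_sup ::
  "'a::hilbert set \<Rightarrow> real measure \<Rightarrow> (real set \<Rightarrow> 'a \<Rightarrow> 'a) \<Rightarrow> (real \<Rightarrow> real) \<Rightarrow> real" where
  "ess_sup V N E g = Inf {c. 0 \<le> c \<and> spectral_null V E {t \<in> space N. c < g t}}"

definition spectral_sum ::
  "real measure \<Rightarrow> (real set \<Rightarrow> 'a::hilbert \<Rightarrow> 'a) \<Rightarrow> (real \<Rightarrow> complex) \<Rightarrow> 'a \<Rightarrow> 'a" where
  "spectral_sum N E s x = (\<Sum>c\<in>s ` space N. scaleK c (E (s -` {c} \<inter> space N) x))"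

text \<open>
  \<open>\<integral> f dE\<close> applied to \<open>x\<close>, for \<open>f \<in> L\<^sup>\<infinity>\<close>: the limit of the integrals of any simple functions that
  converge to \<open>f\<close> in \<open>L\<^sup>\<infinity>\<close>. For the spectral measure \<open>E\<close> of an operator \<open>H\<close> this is \<open>f(H) x\<close>.
\<close>

definition spectral_integral ::
  "'a::hilbert set \<Rightarrow> real measure \<Rightarrow> (real set \<Rightarrow> 'a \<Rightarrow> 'a) \<Rightarrow> (real \<Rightarrow> complex) \<Rightarrow> 'a \<Rightarrow> 'a" where
  "spectral_integral V N E f x = (THE y. \<exists>s::nat \<Rightarrow> real \<Rightarrow> complex.
     (\<forall>n. simple_function N (s n) \<and> s n ` space N \<subseteq> scalars TYPE('a)) \<and>
     (\<forall>e>0. \<forall>\<^sub>F n in sequentially. spectral_null V E {t \<in> space N. e < norm (s n t - f t)}) \<and>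
     (\<lambda>n. spectral_sum N E (s n) x) \<longlonglongrightarrow> y)"

text \<open>The spectrum of a selfadjoint operator is real; this is its Borel structure.\<close>

definition spectrum_borel :: "'a::hilbert set \<Rightarrow> ('a \<Rightarrow> 'a) \<Rightarrow> real measure" where
  "spectrum_borel V T = restrict_space borel {t. complex_of_real t \<in> spectrum V T}"

definition spectral_measure ::
  "'a::hilbert set \<Rightarrow> ('a \<Rightarrow> 'a) \<Rightarrow> (real set \<Rightarrow> 'a \<Rightarrow> 'a) \<Rightarrow> bool" where
  "spectral_measure V T E \<longleftrightarrow> projection_valued_measure V (spectrum_borel V T) E \<and>
     (\<forall>x\<in>V. T x = spectral_integral V (spectrum_borel V T) E complex_of_real x)"


subsection \<open>The Halmos decomposition\<close>

text \<open>
  The summands are closed subspaces \<open>D i j\<close> (\<open>i, j < 2\<close>), \<open>M\<close> and \<open>U ` M\<close> of the ambient space,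
  where the unitary \<open>U\<close> identifies the two copies of \<open>M\<close>. The vector with components \<open>d i j\<close>, \<open>x\<close>
  and \<open>y\<close> (the last one as an element of \<open>M\<close>) is \<open>assemble U d x y\<close>.
\<close>

definition assemble :: "('a::hilbert \<Rightarrow> 'a) \<Rightarrow> (nat \<Rightarrow> nat \<Rightarrow> 'a) \<Rightarrow> 'a \<Rightarrow> 'a \<Rightarrow> 'a" where
  "assemble U d x y = (\<Sum>i<2. \<Sum>j<2. d i j) + x + U y"

definition components ::
  "(nat \<Rightarrow> nat \<Rightarrow> 'a::hilbert set) \<Rightarrow> 'a set \<Rightarrow> (nat \<Rightarrow> nat \<Rightarrow> 'a) \<Rightarrow> 'a \<Rightarrow> 'a \<Rightarrow> bool" where
  "components D M d x y \<longleftrightarrow> (\<forall>i<2. \<forall>j<2. d i j \<in> D i j) \<and> x \<in> M \<and> y \<in> M"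

definition orthogonal_decomposition ::
  "(nat \<Rightarrow> nat \<Rightarrow> 'a::hilbert set) \<Rightarrow> 'a set \<Rightarrow> ('a \<Rightarrow> 'a) \<Rightarrow> bool" where
  "orthogonal_decomposition D M U \<longleftrightarrow>
     (\<forall>i<2. \<forall>j<2. closed_subspace (D i j)) \<and> closed_subspace M \<and> closed_subspace (U ` M) \<and>
     unitary_between M (U ` M) U \<and>
     (\<forall>i<2. \<forall>j<2. \<forall>k<2. \<forall>l<2. (i, j) \<noteq> (k, l) \<longrightarrow> orthogonal_sets (D i j) (D k l)) \<and>
     (\<forall>i<2. \<forall>j<2. orthogonal_sets (D i j) M \<and> orthogonal_sets (D i j) (U ` M)) \<and>
     orthogonal_sets M (U ` M) \<and>
     (\<forall>v. \<exists>d x y. components D M d x y \<and> v = assemble U d x y)"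

definition halmos_decomposition ::
  "('a::hilbert \<Rightarrow> 'a) \<Rightarrow> ('a \<Rightarrow> 'a) \<Rightarrow> (nat \<Rightarrow> nat \<Rightarrow> 'a set) \<Rightarrow> 'a set \<Rightarrow> ('a \<Rightarrow> 'a) \<Rightarrow> ('a \<Rightarrow> 'a) \<Rightarrow> bool"
where
  "halmos_decomposition P Q D M U H \<longleftrightarrow>
     orthogonal_decomposition D M U \<and>
     selfadjoint M H \<and> spectrum M H \<subseteq> complex_of_real ` {0..1} \<and>
     \<not> eigenvalue M H 0 \<and> \<not> eigenvalue M H 1 \<and>
     (\<forall>d x y. components D M d x y \<longrightarrow>
        P (assemble U d x y) = assemble U (\<lambda>i j. if i = 0 then d i j else 0) x 0) \<and>
     (\<exists>S. positive_sqrt M (\<lambda>x. H (x - H x)) S \<and>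
        (\<forall>d x y. components D M d x y \<longrightarrow>
           Q (assemble U d x y) =
             assemble U (\<lambda>i j. if j = 0 then d i j else 0) (x - H x + S y) (S x + H y)))"

text \<open>The operator \<open>a\<^sub>0\<^sub>0 I \<oplus> a\<^sub>0\<^sub>1 I \<oplus> a\<^sub>1\<^sub>0 I \<oplus> a\<^sub>1\<^sub>1 I \<oplus> [\<phi>\<^sub>i\<^sub>j(H)]\<close>, where \<open>E\<close> is the spectral measure of \<open>H\<close>.\<close>

definition block_operator ::
  "(nat \<Rightarrow> nat \<Rightarrow> 'a::hilbert set) \<Rightarrow> 'a set \<Rightarrow> ('a \<Rightarrow> 'a) \<Rightarrow> ('a \<Rightarrow> 'a) \<Rightarrow> (real set \<Rightarrow> 'a \<Rightarrow> 'a) \<Rightarrow>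
     (nat \<Rightarrow> nat \<Rightarrow> complex) \<Rightarrow> (nat \<Rightarrow> nat \<Rightarrow> real \<Rightarrow> complex) \<Rightarrow> ('a \<Rightarrow> 'a) \<Rightarrow> bool" where
  "block_operator D M U H E a f A \<longleftrightarrow>
     (let F = (\<lambda>i j. spectral_integral M (spectrum_borel M H) E (f i j)) in
      \<forall>d x y. components D M d x y \<longrightarrow>
        A (assemble U d x y) =
          assemble U (\<lambda>i j. scaleK (a i j) (d i j)) (F 0 0 x + F 0 1 y) (F 1 0 x + F 1 1 y))"

definition Lam :: "(nat \<Rightarrow> nat \<Rightarrow> 'a::hilbert set) \<Rightarrow> (nat \<times> nat) set" where
  "Lam D = {(i, j). i < 2 \<and> j < 2 \<and> D i j \<noteq> {0}}"

text \<open>In the extended reals, so that the maximum over the empty set is \<open>- \<infinity>\<close>.\<close>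

definition a_max :: "(nat \<Rightarrow> nat \<Rightarrow> 'a::hilbert set) \<Rightarrow> (nat \<Rightarrow> nat \<Rightarrow> complex) \<Rightarrow> ereal" where
  "a_max D a = (SUP (j, k)\<in>Lam D. ereal (norm (a j k)))"

definition phi :: "(nat \<Rightarrow> nat \<Rightarrow> real \<Rightarrow> complex) \<Rightarrow> real \<Rightarrow> real" where
  "phi f t = (\<Sum>i<2. \<Sum>j<2. (norm (f i j t))\<^sup>2)"

definition omega :: "(nat \<Rightarrow> nat \<Rightarrow> real \<Rightarrow> complex) \<Rightarrow> real \<Rightarrow> complex" where
  "omega f t = f 0 0 t * f 1 1 t - f 0 1 t * f 1 0 t"

definition psi :: "(nat \<Rightarrow> nat \<Rightarrow> real \<Rightarrow> complex) \<Rightarrow> real \<Rightarrow> real" where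
  "psi f t = phi f t + sqrt ((phi f t)\<^sup>2 - 4 * (norm (omega f t))\<^sup>2)"

text \<open>
  As the entries are only defined up to null sets, the maximum of \<open>\<psi>\<close> over the spectrum is an
  essential one, and need not be attained at any point.
\<close>

definition lambda_max ::
  "'a::hilbert set \<Rightarrow> ('a \<Rightarrow> 'a) \<Rightarrow> (real set \<Rightarrow> 'a \<Rightarrow> 'a) \<Rightarrow> (nat \<Rightarrow> nat \<Rightarrow> real \<Rightarrow> complex) \<Rightarrow> real" where
  "lambda_max M H E f = ess_sup M (spectrum_borel M H) E (\<lambda>t. psi f t / 2)"

definition Sigma_max ::
  "'a::hilbert set \<Rightarrow> ('a \<Rightarrow> 'a) \<Rightarrow> (real set \<Rightarrow> 'a \<Rightarrow> 'a) \<Rightarrow> (nat \<Rightarrow> nat \<Rightarrow> real \<Rightarrow> complex) \<Rightarrow> real set" where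
  "Sigma_max M H E f =
     {t \<in> space (spectrum_borel M H). psi f t = ess_sup M (spectrum_borel M H) E (psi f)}"

end

theory Submission imports Defs begin

text \<open>
  The squared norm of the matrix \<open>f(t)\<close> is \<open>\<psi>(t) / 2\<close>, so the block \<open>\<Phi> = [f\<^sub>i\<^sub>j(H)]\<close> satisfies
  \<open>\<parallel>\<Phi> w\<parallel>\<^sup>2 \<le> \<lambda>\<^sub>m\<^sub>a\<^sub>x \<parallel>w\<parallel>\<^sup>2\<close>. If \<open>{\<psi> / 2 = \<lambda>\<^sub>m\<^sub>a\<^sub>x}\<close> is null, then any \<open>w \<noteq> 0\<close> has a nonzero component in the
  spectral subspace of some set \<open>{\<psi> / 2 \<le> \<lambda>\<^sub>m\<^sub>a\<^sub>x - 1 / n}\<close>, and the inequality is strict. Conversely, over a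
  non-null set on which \<open>\<psi> / 2 \<ge> c\<close> the singular vectors of \<open>f(t)\<close> can be chosen measurably and bounded, and
  the functional calculus turns them into a \<open>w\<close> with \<open>\<parallel>\<Phi> w\<parallel>\<^sup>2 \<ge> c \<parallel>w\<parallel>\<^sup>2\<close>. Applied to \<open>{\<psi> / 2 = \<lambda>\<^sub>m\<^sub>a\<^sub>x}\<close> this
  gives attainment, and applied to \<open>{\<psi> / 2 > c}\<close> with \<open>c < \<lambda>\<^sub>m\<^sub>a\<^sub>x\<close> it gives \<open>\<parallel>\<Phi>\<parallel>\<^sup>2 = \<lambda>\<^sub>m\<^sub>a\<^sub>x\<close>. The scalar
  blocks \<open>a\<^sub>i\<^sub>j I\<close> attain their norms trivially.

  Integrals are never formed: pointwise inequalities between the \<open>f\<^sub>i\<^sub>j\<close> are transferred to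
  \<open>\<parallel>E(S) w\<parallel>\<^sup>2\<close> by cutting \<open>S\<close> into finitely many cells on which all functions are nearly constant.
\<close>

section \<open>Hilbert space preliminaries\<close>

lemma scalars_of_real [simp]: "of_real r \<in> scalars TYPE('a::hilbert)"
  using scalars_cases[where 'a='a] by (elim disjE) simp_all

lemma scalars_add: "c \<in> scalars TYPE('a::hilbert) \<Longrightarrow> d \<in> scalars TYPE('a) \<Longrightarrow> c + d \<in> scalars TYPE('a)"
  using scalars_cases[where 'a='a] by (elim disjE) simp_all

lemma scalars_diff: "c \<in> scalars TYPE('a::hilbert) \<Longrightarrow> d \<in> scalars TYPE('a) \<Longrightarrow> c - d \<in> scalars TYPE('a)"
  using scalars_cases[where 'a='a] by (elim disjE) simp_all

lemma scalars_mult: "c \<in> scalars TYPE('a::hilbert) \<Longrightarrow> d \<in> scalars TYPE('a) \<Longrightarrow> c * d \<in> scalars TYPE('a)"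
  using scalars_cases[where 'a='a] by (elim disjE) simp_all

lemma scalars_divide: "c \<in> scalars TYPE('a::hilbert) \<Longrightarrow> d \<in> scalars TYPE('a) \<Longrightarrow> c / d \<in> scalars TYPE('a)"
  using scalars_cases[where 'a='a] by (elim disjE) simp_all

lemma scalars_cnj: "c \<in> scalars TYPE('a::hilbert) \<Longrightarrow> cnj c \<in> scalars TYPE('a)"
  using scalars_cases[where 'a='a] by (elim disjE) (simp_all add: Reals_cnj_iff)

lemma scalars_0 [simp]: "0 \<in> scalars TYPE('a::hilbert)"
  using scalars_of_real[of 0] by simp

lemma scalars_1 [simp]: "1 \<in> scalars TYPE('a::hilbert)"
  using scalars_of_real[of 1] by simp

lemma kinner_add_right: "kinner x (y + z) = kinner x y + kinner (x::'a::hilbert) z"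
proof -
  have "kinner x (y + z) = cnj (kinner (y + z) x)"
    by (rule kinner_commute)
  also have "\<dots> = cnj (kinner y x) + cnj (kinner z x)"
    by (simp add: kinner_add_left)
  also have "\<dots> = kinner x y + kinner x z"
    by (simp add: kinner_commute[symmetric])
  finally show ?thesis .
qed

text \<open>Polarization: both inner products induce the same norm, so expanding the square of
  \<open>norm (x + y)\<close> in each of them and comparing gives the identity. Orthogonality is
  used below through the real \<open>inner\<close>.\<close>

lemma Re_kinner: "Re (kinner x y) = inner x (y::'a::hilbert)"
proof -
  have "complex_of_real ((norm (x + y))\<^sup>2) =
      of_real ((norm x)\<^sup>2) + of_real ((norm y)\<^sup>2) + (kinner x y + cnj (kinner x y))"
    by (simp only: kinner_self[symmetric] kinner_add_left kinner_add_right kinner_commute[of y x])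
       (simp add: kinner_self)
  then have "(norm (x + y))\<^sup>2 = (norm x)\<^sup>2 + (norm y)\<^sup>2 + 2 * Re (kinner x y)"
    by (simp add: complex_eq_iff)
  then show ?thesis
    by (simp add: power2_norm_eq_inner inner_add inner_commute)
qed

lemma norm_scaleK:
  assumes "c \<in> scalars TYPE('a)"
  shows "norm (scaleK c (x::'a::hilbert)) = norm c * norm x"
proof -
  have "complex_of_real ((norm (scaleK c x))\<^sup>2) = c * cnj (c * kinner x x)"
    unfolding kinner_self[symmetric]
    using assms kinner_commute[of "scaleK c x" x] by (simp add: kinner_scaleK_left)
  also have "\<dots> = of_real ((norm c * norm x)\<^sup>2)"
    by (simp add: kinner_self power_mult_distrib complex_norm_square[symmetric] mult.assoc[symmetric])
  finally have "(norm (scaleK c x))\<^sup>2 = (norm c * norm x)\<^sup>2"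
    by (simp only: of_real_eq_iff)
  then show ?thesis
    by (simp add: power2_eq_iff_nonneg)
qed

lemma scaleK_zero_left [simp]: "scaleK 0 (x::'a::hilbert) = 0"
  using scaleK_of_real[of 0 x] by simp

lemma scaleK_one [simp]: "scaleK 1 (x::'a::hilbert) = x"
  using scaleK_of_real[of 1 x] by simp

lemma scaleK_zero_right [simp]: "c \<in> scalars TYPE('a) \<Longrightarrow> scaleK c 0 = (0::'a::hilbert)"
  using norm_scaleK[of c "0::'a"] by simp

lemma scaleK_minus_right: "c \<in> scalars TYPE('a) \<Longrightarrow> scaleK c (- x) = - scaleK c (x::'a::hilbert)"
  using scaleK_add_right[of c x "- x"] by (simp add: eq_neg_iff_add_eq_0 add.commute)

lemma scaleK_diff_right:
  "c \<in> scalars TYPE('a) \<Longrightarrow> scaleK c (x - y) = scaleK c x - scaleK c (y::'a::hilbert)"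
  using scaleK_add_right[of c x "- y"] scaleK_minus_right[of c y] by simp

lemma scaleK_diff_left:
  "c \<in> scalars TYPE('a) \<Longrightarrow> d \<in> scalars TYPE('a) \<Longrightarrow>
    scaleK (c - d) x = scaleK c x - scaleK d (x::'a::hilbert)"
  using scaleK_add_left[of "c - d" d x] scalars_diff[where 'a='a, of c d] by (simp add: algebra_simps)

lemma scaleR_scaleK_commute:
  "c \<in> scalars TYPE('a) \<Longrightarrow> r *\<^sub>R scaleK c x = scaleK c (r *\<^sub>R (x::'a::hilbert))"
  using scaleK_scaleK[of c "of_real r" x] scaleK_scaleK[of "of_real r" c x]
  by (simp add: scaleK_of_real mult.commute)

lemma inner_scaleK_scaleK:
  assumes "c \<in> scalars TYPE('a)" "d \<in> scalars TYPE('a)"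
  shows "inner (scaleK c x) (scaleK d (y::'a::hilbert)) = Re (c * cnj d * kinner x y)"
proof -
  have "kinner (scaleK c x) (scaleK d y) = c * cnj (d * kinner y x)"
    using assms kinner_commute[of "scaleK d y" x] by (simp add: kinner_scaleK_left)
  then show ?thesis
    using kinner_commute[of x y] by (simp add: Re_kinner[symmetric] mult.assoc)
qed

lemma Re_mult_kinner_le:
  assumes "c \<in> scalars TYPE('a)"
  shows "Re (c * kinner x y) \<le> norm c * norm x * norm (y::'a::hilbert)"
  using assms norm_cauchy_schwarz[of "scaleK c x" y]
  by (simp add: kinner_scaleK_left[symmetric] Re_kinner norm_scaleK)

lemma norm_Pair_power2: "(norm (x, y))\<^sup>2 = (norm x)\<^sup>2 + (norm y)\<^sup>2"
  by (simp add: norm_Pair)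

lemma norm_Pair_le_add: "norm (x, y) \<le> norm x + norm y"
  by (simp add: norm_Pair sqrt_sum_squares_le_sum)

lemma closed_subspace_zero: "closed_subspace V \<Longrightarrow> 0 \<in> V"
  and closed_subspace_add: "closed_subspace V \<Longrightarrow> x \<in> V \<Longrightarrow> y \<in> V \<Longrightarrow> x + y \<in> V"
  and closed_subspace_scaleK:
    "closed_subspace V \<Longrightarrow> c \<in> scalars TYPE('a::hilbert) \<Longrightarrow> x \<in> V \<Longrightarrow> scaleK c (x::'a) \<in> V"
  and closed_subspace_closed: "closed_subspace V \<Longrightarrow> closed V"
  by (auto simp: closed_subspace_def)

lemma closed_subspace_scaleR: "closed_subspace V \<Longrightarrow> x \<in> V \<Longrightarrow> r *\<^sub>R x \<in> V"
  using closed_subspace_scaleK[of V "of_real r" x] by (simp add: scaleK_of_real)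

lemma closed_subspace_diff: "closed_subspace V \<Longrightarrow> x \<in> V \<Longrightarrow> y \<in> V \<Longrightarrow> x - y \<in> V"
  using closed_subspace_add[of V x "(-1) *\<^sub>R y"] closed_subspace_scaleR[of V y "-1"] by simp

lemma closed_subspace_sum: "closed_subspace V \<Longrightarrow> (\<And>i. i \<in> I \<Longrightarrow> g i \<in> V) \<Longrightarrow> sum g I \<in> V"
  by (induction I rule: infinite_finite_induct) (auto intro: closed_subspace_zero closed_subspace_add)


section \<open>Two by two matrices\<close>

text \<open>Let \<open>F\<close> be the matrix of the numbers \<open>f i j t\<close> and
  \<open>G\<close> its Gram matrix, the adjoint of \<open>F\<close> times \<open>F\<close>. The
  diagonal of \<open>G\<close> consists of \<open>gram00\<close> and \<open>gram11\<close>, the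
  squared norms of the columns; \<open>gram01\<close> is the inner product of column 0 with column
  1, the conjugate of the upper right entry.\<close>

definition gram00 :: "(nat \<Rightarrow> nat \<Rightarrow> real \<Rightarrow> complex) \<Rightarrow> real \<Rightarrow> real" where
  "gram00 f t = (norm (f 0 0 t))\<^sup>2 + (norm (f 1 0 t))\<^sup>2"

definition gram11 :: "(nat \<Rightarrow> nat \<Rightarrow> real \<Rightarrow> complex) \<Rightarrow> real \<Rightarrow> real" where
  "gram11 f t = (norm (f 0 1 t))\<^sup>2 + (norm (f 1 1 t))\<^sup>2"

definition gram01 :: "(nat \<Rightarrow> nat \<Rightarrow> real \<Rightarrow> complex) \<Rightarrow> real \<Rightarrow> complex" where
  "gram01 f t = f 0 0 t * cnj (f 0 1 t) + f 1 0 t * cnj (f 1 1 t)"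

lemma phi_eq_gram: "phi f t = gram00 f t + gram11 f t"
  by (simp add: phi_def gram00_def gram11_def numeral_2_eq_2)

text \<open>The determinant of \<open>G\<close> is the squared modulus of the determinant of
  \<open>F\<close>; in real coordinates this is a polynomial identity.\<close>

lemma norm_omega_gram: "(norm (omega f t))\<^sup>2 = gram00 f t * gram11 f t - (norm (gram01 f t))\<^sup>2"
  unfolding omega_def gram00_def gram11_def gram01_def cmod_power2
  by simp algebra

text \<open>The radicand is the discriminant of the characteristic polynomial of \<open>G\<close>,
  written as a sum of squares. Hence it is nonnegative, and \<open>psi f t / 2\<close> is the larger
  eigenvalue of \<open>G\<close>.\<close>

lemma psi_eq_gram: "psi f t = gram00 f t + gram11 f t +
    sqrt ((gram00 f t - gram11 f t)\<^sup>2 + 4 * (norm (gram01 f t))\<^sup>2)"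
proof -
  have "(phi f t)\<^sup>2 - 4 * (norm (omega f t))\<^sup>2 =
      (gram00 f t - gram11 f t)\<^sup>2 + 4 * (norm (gram01 f t))\<^sup>2"
    unfolding phi_eq_gram norm_omega_gram by algebra
  then show ?thesis by (simp add: psi_def phi_eq_gram)
qed

lemma gram00_le_psi: "gram00 f t \<le> psi f t / 2"
  and gram11_le_psi: "gram11 f t \<le> psi f t / 2"
proof -
  have "\<bar>gram00 f t - gram11 f t\<bar> \<le> sqrt ((gram00 f t - gram11 f t)\<^sup>2 + 4 * (norm (gram01 f t))\<^sup>2)"
    by (rule real_le_rsqrt) simp
  then show "gram00 f t \<le> psi f t / 2" "gram11 f t \<le> psi f t / 2"
    unfolding psi_eq_gram by (simp_all add: abs_le_iff)
qed

lemma psi_nonneg: "0 \<le> psi f t"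
  using gram00_le_psi[of f t] by (simp add: gram00_def) (smt (verit) zero_le_power2)

lemma psi_char_poly:
  "(psi f t / 2 - gram00 f t) * (psi f t / 2 - gram11 f t) = (norm (gram01 f t))\<^sup>2"
proof -
  define r where "r = sqrt ((gram00 f t - gram11 f t)\<^sup>2 + 4 * (norm (gram01 f t))\<^sup>2)"
  have "r\<^sup>2 = (gram00 f t - gram11 f t)\<^sup>2 + 4 * (norm (gram01 f t))\<^sup>2"
    by (simp add: r_def)
  moreover have "psi f t = gram00 f t + gram11 f t + r"
    by (simp add: psi_eq_gram r_def)
  ultimately show ?thesis
    by (simp add: power2_eq_square field_simps)
qed

lemma psi_le_2_phi: "psi f t \<le> 2 * phi f t"
proof -
  have "sqrt ((phi f t)\<^sup>2 - 4 * (norm (omega f t))\<^sup>2) \<le> sqrt ((phi f t)\<^sup>2)"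
    by (intro real_sqrt_le_mono) simp
  moreover have "phi f t \<ge> 0"
    by (simp add: phi_def sum_nonneg)
  ultimately show ?thesis by (simp add: psi_def)
qed

text \<open>The matrix \<open>psi f t / 2 - G\<close> has nonnegative diagonal entries
  \<open>p\<close>, \<open>q\<close> and determinant zero, so the cross term is at most
  \<open>2 * (sqrt p * norm u) * (sqrt q * norm v)\<close>, which the diagonal terms absorb. The
  entries act on Hilbert space vectors, in order to apply to the pair \<open>E B x\<close>,
  \<open>E B y\<close>.\<close>

lemma norm_matrix_apply_le:
  fixes u v :: "'a::hilbert"
  assumes f: "\<And>i j. i < 2 \<Longrightarrow> j < 2 \<Longrightarrow> f i j t \<in> scalars TYPE('a)"
  shows "(norm (scaleK (f 0 0 t) u + scaleK (f 0 1 t) v))\<^sup>2 +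
      (norm (scaleK (f 1 0 t) u + scaleK (f 1 1 t) v))\<^sup>2 \<le> psi f t / 2 * ((norm u)\<^sup>2 + (norm v)\<^sup>2)"
proof -
  have s: "f 0 0 t \<in> scalars TYPE('a)" "f 0 1 t \<in> scalars TYPE('a)"
    "f 1 0 t \<in> scalars TYPE('a)" "f 1 1 t \<in> scalars TYPE('a)"
    using f by auto
  have g: "gram01 f t \<in> scalars TYPE('a)"
    unfolding gram01_def using s by (intro scalars_add scalars_mult scalars_cnj)
  define p q where "p = psi f t / 2 - gram00 f t" and "q = psi f t / 2 - gram11 f t"
  have pq: "0 \<le> p" "0 \<le> q" and "p * q = (norm (gram01 f t))\<^sup>2"
    using gram00_le_psi[of f t] gram11_le_psi[of f t] psi_char_poly[of f t]
    by (auto simp: p_def q_def)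
  then have n: "norm (gram01 f t) = sqrt p * sqrt q"
    by (metis norm_ge_zero real_sqrt_mult real_sqrt_unique)
  have row: "(norm (scaleK c u + scaleK d v))\<^sup>2 =
      (norm c)\<^sup>2 * (norm u)\<^sup>2 + (norm d)\<^sup>2 * (norm v)\<^sup>2 + 2 * Re (c * cnj d * kinner u v)"
    if "c \<in> scalars TYPE('a)" "d \<in> scalars TYPE('a)" for c d
    using that dot_norm[of "scaleK c u" "scaleK d v"]
    by (simp add: inner_scaleK_scaleK norm_scaleK power_mult_distrib field_simps)
  have "(norm (scaleK (f 0 0 t) u + scaleK (f 0 1 t) v))\<^sup>2 +
      (norm (scaleK (f 1 0 t) u + scaleK (f 1 1 t) v))\<^sup>2 =
      gram00 f t * (norm u)\<^sup>2 + gram11 f t * (norm v)\<^sup>2 + 2 * Re (gram01 f t * kinner u v)"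
    unfolding row[OF s(1,2)] row[OF s(3,4)] gram00_def gram11_def gram01_def
    by (simp add: algebra_simps)
  also have "\<dots> \<le> gram00 f t * (norm u)\<^sup>2 + gram11 f t * (norm v)\<^sup>2 +
      2 * (sqrt p * norm u) * (sqrt q * norm v)"
    using Re_mult_kinner_le[OF g, of u v] by (simp add: n mult_ac)
  also have "\<dots> \<le> gram00 f t * (norm u)\<^sup>2 + gram11 f t * (norm v)\<^sup>2 +
      ((sqrt p * norm u)\<^sup>2 + (sqrt q * norm v)\<^sup>2)"
    using sum_squares_bound[of "sqrt p * norm u" "sqrt q * norm v"] by simp
  also have "\<dots> = psi f t / 2 * ((norm u)\<^sup>2 + (norm v)\<^sup>2)"
    using pq by (simp add: power_mult_distrib p_def q_def algebra_simps)
  finally show ?thesis .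
qed

text \<open>The first row of the singular matrix \<open>psi f t / 2 - G\<close> annihilates
  \<open>(v, 1)\<close>. That row is nonzero by hypothesis, so \<open>(v, 1)\<close> is an
  eigenvector of \<open>G\<close> for \<open>psi f t / 2\<close>.\<close>

lemma matrix_singular_vector:
  assumes "gram00 f t \<noteq> psi f t / 2"
  defines "v \<equiv> cnj (gram01 f t) / of_real (psi f t / 2 - gram00 f t)"
  shows "(norm (f 0 0 t * v + f 0 1 t))\<^sup>2 + (norm (f 1 0 t * v + f 1 1 t))\<^sup>2 =
    psi f t / 2 * ((norm v)\<^sup>2 + 1)"
proof -
  define e where "e = psi f t / 2 - gram00 f t"
  have e: "e \<noteq> 0" using assms by (simp add: e_def)
  have char: "(norm (gram01 f t))\<^sup>2 = e * (psi f t / 2 - gram11 f t)"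
    by (simp add: e_def psi_char_poly)
  have row: "(norm (c * v + d))\<^sup>2 = (norm c)\<^sup>2 * (norm v)\<^sup>2 + (norm d)\<^sup>2 + 2 * Re (c * cnj d * v)" for c d
    unfolding cmod_power2 by simp algebra
  have v: "v = cnj (gram01 f t) / of_real e" by (simp add: v_def e_def)
  have "(norm (f 0 0 t * v + f 0 1 t))\<^sup>2 + (norm (f 1 0 t * v + f 1 1 t))\<^sup>2 =
      gram00 f t * (norm v)\<^sup>2 + gram11 f t + 2 * Re (gram01 f t * v)"
    unfolding row gram00_def gram11_def gram01_def by (simp add: algebra_simps)
  also have "Re (gram01 f t * v) = psi f t / 2 - gram11 f t"
  proof -
    have "gram01 f t * v = of_real ((norm (gram01 f t))\<^sup>2 / e)"
      by (simp add: v complex_norm_square[symmetric])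
    then show ?thesis using e by (simp add: char)
  qed
  finally have "(norm (f 0 0 t * v + f 0 1 t))\<^sup>2 + (norm (f 1 0 t * v + f 1 1 t))\<^sup>2 =
      gram00 f t * (norm v)\<^sup>2 + gram11 f t + 2 * (psi f t / 2 - gram11 f t)" .
  moreover have "e * (norm v)\<^sup>2 = psi f t / 2 - gram11 f t"
    using e char by (simp add: v norm_divide power_divide power2_eq_square)
  then have "psi f t / 2 * (norm v)\<^sup>2 = gram00 f t * (norm v)\<^sup>2 + psi f t / 2 - gram11 f t"
    by (simp add: e_def left_diff_distrib)
  ultimately show ?thesis by (simp add: field_simps)
qed

section \<open>Projection-valued measures\<close>

definition additive_on :: "real measure \<Rightarrow> (real set \<Rightarrow> real) \<Rightarrow> bool" where
  "additive_on N m \<longleftrightarrow>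
    (\<forall>S\<in>sets N. \<forall>T\<in>sets N. S \<inter> T = {} \<longrightarrow> m (S \<union> T) = m S + m T)"

lemma additive_onD:
  "additive_on N m \<Longrightarrow> S \<in> sets N \<Longrightarrow> T \<in> sets N \<Longrightarrow> S \<inter> T = {} \<Longrightarrow> m (S \<union> T) = m S + m T"
  by (simp add: additive_on_def)

lemma additive_on_empty: "additive_on N m \<Longrightarrow> m {} = 0"
  using additive_onD[of N m "{}" "{}"] by simp

text \<open>No sign is imposed on these set functions, so the two sides of an inequality can be
  merged into one difference whose nonnegativity is the goal.\<close>

lemma additive_on_add: "additive_on N m \<Longrightarrow> additive_on N m' \<Longrightarrow> additive_on N (\<lambda>S. m S + m' S)"
  and additive_on_diff: "additive_on N m \<Longrightarrow> additive_on N m' \<Longrightarrow> additive_on N (\<lambda>S. m S - m' S)"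
  and additive_on_mult: "additive_on N m \<Longrightarrow> additive_on N (\<lambda>S. c * m S)"
  by (auto simp: additive_on_def algebra_simps)

lemma additive_on_finite_UN:
  assumes "additive_on N m" "finite K" "\<And>k. k \<in> K \<Longrightarrow> B k \<in> sets N" "disjoint_family_on B K"
  shows "m (\<Union>k\<in>K. B k) = (\<Sum>k\<in>K. m (B k))"
  using assms(2-)
proof (induction K rule: finite_induct)
  case empty
  then show ?case using additive_on_empty[OF assms(1)] by simp
next
  case (insert k K)
  have "B k \<inter> (\<Union>k\<in>K. B k) = {}"
    using insert by (auto simp: disjoint_family_on_def)
  moreover have "(\<Union>k\<in>K. B k) \<in> sets N"
    using insert by auto
  ultimately have "m (B k \<union> (\<Union>k\<in>K. B k)) = m (B k) + m (\<Union>k\<in>K. B k)"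
    using insert by (intro additive_onD[OF assms(1)]) auto
  moreover have "disjoint_family_on B K"
    using insert by (auto simp: disjoint_family_on_def)
  ultimately show ?case using insert by simp
qed

lemma additive_on_level_sets:
  assumes "additive_on N m" "finite (k ` S)" "\<And>l. l \<in> k ` S \<Longrightarrow> {t \<in> S. k t = l} \<in> sets N"
  shows "m S = (\<Sum>l\<in>k ` S. m {t \<in> S. k t = l})"
proof -
  have "m (\<Union>l\<in>k ` S. {t \<in> S. k t = l}) = (\<Sum>l\<in>k ` S. m {t \<in> S. k t = l})"
    using assms by (intro additive_on_finite_UN[where N=N]) (auto simp: disjoint_family_on_def)
  moreover have "(\<Union>l\<in>k ` S. {t \<in> S. k t = l}) = S" by auto
  ultimately show ?thesis by simp
qed

text \<open>The index of the square of side \<open>h\<close> that contains \<open>z\<close>. A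
  bounded region meets finitely many squares, so a bounded function induces a finite partition of
  its domain.\<close>

definition grid :: "real \<Rightarrow> complex \<Rightarrow> int \<times> int" where
  "grid h z = (\<lfloor>Re z / h\<rfloor>, \<lfloor>Im z / h\<rfloor>)"

lemma floor_divide_eq_imp_close:
  assumes "\<lfloor>x / h\<rfloor> = \<lfloor>y / h\<rfloor>" "(h::real) > 0"
  shows "\<bar>x - y\<bar> \<le> h"
proof -
  have "\<bar>x / h - y / h\<bar> \<le> 1"
    using assms(1) by linarith
  then show ?thesis
    using assms(2) by (simp add: diff_divide_distrib[symmetric] abs_divide)
qed

lemma norm_diff_le_of_grid_eq:
  assumes "grid h z = grid h w" "h > 0"
  shows "norm (z - w) \<le> 2 * h"
proof -
  have "\<bar>Re z - Re w\<bar> \<le> h" "\<bar>Im z - Im w\<bar> \<le> h"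
    using assms by (auto simp: grid_def intro!: floor_divide_eq_imp_close)
  then show ?thesis
    using cmod_le[of "z - w"] by simp
qed

lemma finite_grid_image:
  assumes "h > 0"
  shows "finite (grid h ` cball 0 C)"
proof (rule finite_subset)
  let ?I = "{\<lfloor>- C / h\<rfloor>..\<lfloor>C / h\<rfloor>}"
  have I: "\<lfloor>x / h\<rfloor> \<in> ?I" if "\<bar>x\<bar> \<le> C" for x
  proof -
    have "- C / h \<le> x / h" "x / h \<le> C / h"
      using that assms by (auto intro!: divide_right_mono simp del: divide_minus_left)
    then show ?thesis
      unfolding atLeastAtMost_iff by (intro conjI floor_mono)
  qed
  show "grid h ` cball 0 C \<subseteq> ?I \<times> ?I"
  proof (rule image_subsetI)
    fix z :: complex assume "z \<in> cball 0 C"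
    then have "\<bar>Re z\<bar> \<le> C" "\<bar>Im z\<bar> \<le> C"
      using abs_Re_le_cmod[of z] abs_Im_le_cmod[of z] by auto
    then show "grid h z \<in> ?I \<times> ?I"
      unfolding grid_def by (intro SigmaI I)
  qed
qed simp

lemma measurable_grid_level:
  assumes [measurable]: "g \<in> borel_measurable N"
  shows "{t \<in> space N. grid h (g t) = l} \<in> sets N"
proof -
  have "{t \<in> space N. \<lfloor>Re (g t) / h\<rfloor> = fst l \<and> \<lfloor>Im (g t) / h\<rfloor> = snd l} \<in> sets N"
    by measurable
  then show ?thesis
    by (simp add: grid_def prod_eq_iff)
qed

lemma measurable_grid_map_level:
  assumes "set gs \<subseteq> borel_measurable N"
  shows "{t \<in> space N. map (\<lambda>g. grid h (g t)) gs = l} \<in> sets N"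
  using assms
proof (induction gs arbitrary: l)
  case Nil
  then show ?case by (cases l) auto
next
  case (Cons g gs)
  show ?case
  proof (cases l)
    case Nil
    then show ?thesis by simp
  next
    case l: (Cons a l')
    have "{t \<in> space N. map (\<lambda>g. grid h (g t)) (g # gs) = l} =
      {t \<in> space N. grid h (g t) = a} \<inter> {t \<in> space N. map (\<lambda>g. grid h (g t)) gs = l'}"
      using l by auto
    also have "\<dots> \<in> sets N"
      using Cons by (intro sets.Int measurable_grid_level) auto
    finally show ?thesis .
  qed
qed

text \<open>
  A pointwise inequality between finitely many bounded functions is integrated by verifying it,
  up to an error proportional to \<open>\<delta>\<close>, on sets where the functions oscillate by at most \<open>\<delta>\<close>.
\<close>

lemma additive_nonneg_by_cells:
  fixes gs :: "(real \<Rightarrow> complex) list"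
  assumes S: "S \<in> sets N" and add: "additive_on N \<nu>" "additive_on N \<mu>"
    and gs: "set gs \<subseteq> borel_measurable N"
    and bd: "\<And>g t. g \<in> set gs \<Longrightarrow> t \<in> S \<Longrightarrow> norm (g t) \<le> C"
    and step: "\<And>\<delta> B t. 0 < \<delta> \<Longrightarrow> \<delta> \<le> 1 \<Longrightarrow> B \<in> sets N \<Longrightarrow> B \<subseteq> S \<Longrightarrow> t \<in> B \<Longrightarrow>
      (\<And>g s. g \<in> set gs \<Longrightarrow> s \<in> B \<Longrightarrow> norm (g s - g t) \<le> \<delta>) \<Longrightarrow> - (K * \<delta> * \<mu> B) \<le> \<nu> B"
  shows "0 \<le> \<nu> S"
proof (rule ccontr)
  have bound: "- (K * \<delta> * \<mu> S) \<le> \<nu> S" if \<delta>: "0 < \<delta>" "\<delta> \<le> 1" for \<delta>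
  proof -
    \<comment> \<open>Points share a cell when each function in \<open>gs\<close> sends them to the
      same square. Side \<open>\<delta> / 2\<close> gives oscillation at most
      \<open>\<delta>\<close>, because values in one square differ by at most twice the
      side.\<close>
    define k where "k t = map (\<lambda>g. grid (\<delta> / 2) (g t)) gs" for t
    define B where "B l = {t \<in> S. k t = l}" for l
    have SN: "S \<subseteq> space N" using S by (rule sets.sets_into_space)
    have "k ` S \<subseteq> {l. set l \<subseteq> grid (\<delta> / 2) ` cball 0 C \<and> length l = length gs}"
      using bd by (auto simp: k_def)
    then have fin: "finite (k ` S)"
      by (rule finite_subset) (intro finite_lists_length_eq finite_grid_image; use \<delta> in simp)
    have meas: "B l \<in> sets N" for l
    proof -
      have "B l = S \<inter> {t \<in> space N. map (\<lambda>g. grid (\<delta> / 2) (g t)) gs = l}"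
        using SN by (auto simp: B_def k_def)
      then show ?thesis
        using S measurable_grid_map_level[OF gs] by auto
    qed
    have level: "- (K * \<delta> * \<mu> (B l)) \<le> \<nu> (B l)" if l: "l \<in> k ` S" for l
    proof -
      obtain t where t: "t \<in> B l" using l by (auto simp: B_def)
      have "norm (g s - g t) \<le> \<delta>" if "g \<in> set gs" "s \<in> B l" for g s
      proof -
        have "k s = k t" using that t by (simp add: B_def)
        then have "grid (\<delta> / 2) (g s) = grid (\<delta> / 2) (g t)"
          using that by (simp add: k_def)
        then show ?thesis using norm_diff_le_of_grid_eq \<delta> by fastforce
      qed
      then show ?thesis
        using step[OF \<delta> meas _ t] by (auto simp: B_def)
    qed
    have "- (K * \<delta> * \<mu> S) = (\<Sum>l\<in>k ` S. - (K * \<delta> * \<mu> (B l)))"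
      using additive_on_level_sets[OF add(2) fin] meas
      by (simp add: B_def sum_distrib_left sum_negf)
    also have "\<dots> \<le> (\<Sum>l\<in>k ` S. \<nu> (B l))"
      by (rule sum_mono) (rule level)
    also have "\<dots> = \<nu> S"
      using additive_on_level_sets[OF add(1) fin] meas by (simp add: B_def)
    finally show ?thesis .
  qed
  assume "\<not> 0 \<le> \<nu> S"
  then have neg: "- \<nu> S > 0" by simp
  \<comment> \<open>The summand 1 keeps \<open>a\<close> positive when \<open>K * \<mu> S\<close>
    vanishes. With the \<delta> chosen next, the total error is at most half of
    \<open>- \<nu> S\<close>, which contradicts \<open>bound\<close>.\<close>
  define a where "a = \<bar>K * \<mu> S\<bar> + 1"
  define \<delta> where "\<delta> = min 1 (- \<nu> S / (2 * a))"
  have a: "a > 0" "K * \<mu> S \<le> a" by (auto simp: a_def)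
  have \<delta>: "0 < \<delta>" "\<delta> \<le> 1" "\<delta> \<le> - \<nu> S / (2 * a)"
    using neg a by (auto simp: \<delta>_def divide_neg_pos)
  have "- \<nu> S \<le> \<delta> * (K * \<mu> S)" using bound[OF \<delta>(1,2)] by (simp add: mult_ac)
  also have "\<dots> \<le> \<delta> * a" using \<delta> a by (intro mult_left_mono) auto
  also have "\<dots> \<le> - \<nu> S / (2 * a) * a" using \<delta> a by (intro mult_right_mono) auto
  also have "\<dots> = - \<nu> S / 2" using a by simp
  finally show False using neg by simp
qed

section \<open>Algebra of projection-valued measures and their null sets\<close>

locale pvm =
  fixes V :: "'a::hilbert set" and N :: "real measure" and E :: "real set \<Rightarrow> 'a \<Rightarrow> 'a"
  assumes subspace: "closed_subspace V"
    and measure: "projection_valued_measure V N E"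
begin

lemma E_selfadjoint: "S \<in> sets N \<Longrightarrow> selfadjoint V (E S)"
  using measure by (simp add: projection_valued_measure_def orthogonal_projection_def)

lemma E_linear: "S \<in> sets N \<Longrightarrow> linear_between V V (E S)"
  using E_selfadjoint[of S] by (simp add: selfadjoint_def bounded_operator_def)

lemma E_in [simp]: "S \<in> sets N \<Longrightarrow> x \<in> V \<Longrightarrow> E S x \<in> V"
  and E_add: "S \<in> sets N \<Longrightarrow> x \<in> V \<Longrightarrow> y \<in> V \<Longrightarrow> E S (x + y) = E S x + E S y"
  and E_scaleK: "S \<in> sets N \<Longrightarrow> x \<in> V \<Longrightarrow> c \<in> scalars TYPE('a) \<Longrightarrow>
    E S (scaleK c x) = scaleK c (E S x)"
  using E_linear[of S] by (auto simp: linear_between_def)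

lemma E_scaleR: "S \<in> sets N \<Longrightarrow> x \<in> V \<Longrightarrow> E S (r *\<^sub>R x) = r *\<^sub>R E S x"
  using E_scaleK[of S x "of_real r"] by (simp add: scaleK_of_real)

lemma E_zero [simp]: "S \<in> sets N \<Longrightarrow> E S 0 = 0"
  using E_scaleR[of S 0 0] closed_subspace_zero[OF subspace] by simp

lemma E_diff: "S \<in> sets N \<Longrightarrow> x \<in> V \<Longrightarrow> y \<in> V \<Longrightarrow> E S (x - y) = E S x - E S y"
  using E_add[of S "x - y" y] closed_subspace_diff[OF subspace, of x y] by simp

lemma E_sum:
  "S \<in> sets N \<Longrightarrow> (\<And>i. i \<in> I \<Longrightarrow> g i \<in> V) \<Longrightarrow> E S (sum g I) = (\<Sum>i\<in>I. E S (g i))"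
proof (induction I rule: infinite_finite_induct)
  case (insert i I)
  then have "sum g I \<in> V" by (intro closed_subspace_sum[OF subspace]) auto
  with insert show ?case by (simp add: E_add)
qed auto

lemma E_space [simp]: "x \<in> V \<Longrightarrow> E (space N) x = x"
  using measure by (simp add: projection_valued_measure_def)

lemma E_Int: "S \<in> sets N \<Longrightarrow> T \<in> sets N \<Longrightarrow> x \<in> V \<Longrightarrow> E (S \<inter> T) x = E S (E T x)"
  using measure by (simp add: projection_valued_measure_def)

lemma E_subset: "S \<in> sets N \<Longrightarrow> T \<in> sets N \<Longrightarrow> S \<subseteq> T \<Longrightarrow> x \<in> V \<Longrightarrow> E S (E T x) = E S x"
  using E_Int[of S T x] by (simp add: inf.absorb1)

lemma E_sums:
  "range F \<subseteq> sets N \<Longrightarrow> disjoint_family F \<Longrightarrow> x \<in> V \<Longrightarrow> (\<lambda>n. E (F n) x) sums E (\<Union>n. F n) x"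
  using measure by (simp add: projection_valued_measure_def)

lemma E_inner: "S \<in> sets N \<Longrightarrow> x \<in> V \<Longrightarrow> y \<in> V \<Longrightarrow> inner (E S x) y = inner x (E S y)"
  using E_selfadjoint[of S] by (simp add: selfadjoint_def Re_kinner[symmetric])

text \<open>The empty set is a countable disjoint union of copies of itself, and a convergent series
  with constant terms has zero terms.\<close>

lemma E_empty [simp]: "x \<in> V \<Longrightarrow> E {} x = 0"
proof -
  assume "x \<in> V"
  then have "(\<lambda>n::nat. E {} x) sums E {} x"
    using E_sums[of "\<lambda>_::nat. {}" x] by (simp add: disjoint_family_on_def)
  then have "(\<lambda>n::nat. E {} x) \<longlonglongrightarrow> 0"
    by (intro summable_LIMSEQ_zero sums_summable)
  then show ?thesis
    by (simp add: LIMSEQ_const_iff)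
qed

lemma E_Un:
  assumes "S \<in> sets N" "T \<in> sets N" "S \<inter> T = {}" "x \<in> V"
  shows "E (S \<union> T) x = E S x + E T x"
proof -
  have "(\<lambda>n. E (binaryset S T n) x) sums E (\<Union>n. binaryset S T n) x"
    using assms by (intro E_sums)
      (auto simp: range_binaryset_eq disjoint_family_on_def binaryset_def)
  moreover have "(\<lambda>n. E (binaryset S T n) x) sums (E S x + E T x)"
    using assms by (intro binaryset_sums) simp
  ultimately show ?thesis
    unfolding UN_binaryset_eq by (rule sums_unique2)
qed

text \<open>Pythagoras: projections of disjoint sets multiply to \<open>E {}\<close>, hence have
  orthogonal ranges. These scalar set functions take the place of integrals.\<close>

lemma additive_on_norm_E:
  assumes "x \<in> V"
  shows "additive_on N (\<lambda>S. (norm (E S x))\<^sup>2)"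
  unfolding additive_on_def
proof (intro ballI impI)
  fix S T assume ST: "S \<in> sets N" "T \<in> sets N" "S \<inter> T = {}"
  have "inner (E S x) (E T x) = inner x (E S (E T x))"
    using ST assms by (intro E_inner) auto
  then have "inner (E S x) (E T x) = 0"
    using ST assms by (simp add: E_Int[symmetric])
  then show "(norm (E (S \<union> T) x))\<^sup>2 = (norm (E S x))\<^sup>2 + (norm (E T x))\<^sup>2"
    using ST assms by (simp add: E_Un power2_norm_eq_inner inner_add inner_commute)
qed

lemma norm_E_le:
  assumes "S \<in> sets N" "x \<in> V"
  shows "norm (E S x) \<le> norm x"
proof -
  have "(norm (E (S \<union> (space N - S)) x))\<^sup>2 = (norm (E S x))\<^sup>2 + (norm (E (space N - S) x))\<^sup>2"
    using assms by (intro additive_onD[OF additive_on_norm_E]) auto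
  moreover have "S \<union> (space N - S) = space N"
    using sets.sets_into_space[OF assms(1)] by auto
  ultimately have "(norm (E S x))\<^sup>2 \<le> (norm x)\<^sup>2" using assms by simp
  then show ?thesis by (rule power2_le_imp_le) simp
qed

lemma E_countable_UN_zero:
  assumes "\<And>n::nat. F n \<in> sets N" "x \<in> V" "\<And>n. E (F n) x = 0"
  shows "E (\<Union>n. F n) x = 0"
proof -
  have D: "disjointed F n \<in> sets N" for n
    using assms sets.range_disjointed_sets[of F N] by auto
  have "E (disjointed F n) x = 0" for n
    using E_subset[OF D assms(1) disjointed_subset assms(2), of n] assms D by simp
  then have "(\<lambda>n. 0) sums E (\<Union>n. disjointed F n) x"
    using E_sums[of "disjointed F" x] D assms by (auto simp: disjoint_family_disjointed)
  then show ?thesis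
    using sums_unique2[OF _ sums_zero] by (simp add: UN_disjointed_eq)
qed

abbreviation null :: "real set \<Rightarrow> bool" where "null \<equiv> spectral_null V E"

lemma null_countable_UN: "(\<And>n::nat. F n \<in> sets N) \<Longrightarrow> (\<And>n. null (F n)) \<Longrightarrow> null (\<Union>n. F n)"
  unfolding spectral_null_def using E_countable_UN_zero by blast

lemma null_subset: "null T \<Longrightarrow> S \<in> sets N \<Longrightarrow> T \<in> sets N \<Longrightarrow> S \<subseteq> T \<Longrightarrow> null S"
  unfolding spectral_null_def using E_subset by fastforce

lemma null_empty: "null {}"
  by (simp add: spectral_null_def)

lemma null_Un: "S \<in> sets N \<Longrightarrow> T \<in> sets N \<Longrightarrow> null S \<Longrightarrow> null T \<Longrightarrow> null (S \<union> T)"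
  using null_countable_UN[of "binaryset S T"]
  by (auto simp: UN_binaryset_eq binaryset_def null_empty)

lemma E_compl_null:
  assumes "S \<in> sets N" "null (space N - S)" "x \<in> V"
  shows "E S x = x"
proof -
  have "E (S \<union> (space N - S)) x = E S x + E (space N - S) x"
    using assms by (intro E_Un) auto
  moreover have "S \<union> (space N - S) = space N"
    using sets.sets_into_space[OF assms(1)] by auto
  ultimately show ?thesis using assms by (simp add: spectral_null_def)
qed

end

section \<open>The functional calculus, by approximation with simple functions\<close>

context pvm begin

definition scalar_simple :: "(real \<Rightarrow> complex) \<Rightarrow> bool" where
  "scalar_simple s \<longleftrightarrow> simple_function N s \<and> s ` space N \<subseteq> scalars TYPE('a)"

lemma scalar_simple_const: "c \<in> scalars TYPE('a) \<Longrightarrow> scalar_simple (\<lambda>_. c)"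
  by (auto simp: scalar_simple_def)

lemma scalar_simple_level: "scalar_simple s \<Longrightarrow> s -` X \<inter> space N \<in> sets N"
  by (auto simp: scalar_simple_def intro: simple_functionD)

lemma scalar_simple_finite: "scalar_simple s \<Longrightarrow> finite (s ` space N)"
  by (auto simp: scalar_simple_def intro: simple_functionD)

lemma scalar_simple_scalars: "scalar_simple s \<Longrightarrow> t \<in> space N \<Longrightarrow> s t \<in> scalars TYPE('a)"
  by (auto simp: scalar_simple_def)

lemma spectral_sum_in:
  assumes "scalar_simple s" "x \<in> V"
  shows "spectral_sum N E s x \<in> V"
  unfolding spectral_sum_def using assms
  by (intro closed_subspace_sum[OF subspace] closed_subspace_scaleK[OF subspace] E_in
        scalar_simple_level) (auto simp: scalar_simple_scalars)

lemma spectral_sum_scaleR: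
  assumes "scalar_simple s" "x \<in> V"
  shows "spectral_sum N E s (r *\<^sub>R x) = r *\<^sub>R spectral_sum N E s x"
  unfolding spectral_sum_def scaleR_sum_right using assms
  by (intro sum.cong refl)
     (auto simp: E_scaleR scalar_simple_level scaleR_scaleK_commute scalar_simple_scalars)

text \<open>Inside one level set only the summand of that level survives. If \<open>c\<close> is not
  a value of \<open>s\<close>, then \<open>B\<close> is empty.\<close>

lemma E_spectral_sum:
  assumes s: "scalar_simple s" and B: "B \<in> sets N" "B \<subseteq> s -` {c} \<inter> space N" and x: "x \<in> V"
    and c: "c \<in> scalars TYPE('a)"
  shows "E B (spectral_sum N E s x) = scaleK c (E B x)"
proof (cases "c \<in> s ` space N")
  case True
  let ?L = "\<lambda>d. s -` {d} \<inter> space N"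
  have L: "?L d \<in> sets N" for d by (rule scalar_simple_level[OF s])
  have sc: "d \<in> scalars TYPE('a)" if "d \<in> s ` space N" for d
    using that scalar_simple_scalars[OF s] by auto
  have "E B (spectral_sum N E s x) = (\<Sum>d\<in>s ` space N. E B (scaleK d (E (?L d) x)))"
    unfolding spectral_sum_def using B x L sc
    by (intro E_sum closed_subspace_scaleK[OF subspace] E_in) auto
  also have "\<dots> = (\<Sum>d\<in>s ` space N. if d = c then scaleK c (E B x) else 0)"
  proof (intro sum.cong refl)
    fix d assume d: "d \<in> s ` space N"
    have "E B (scaleK d (E (?L d) x)) = scaleK d (E (B \<inter> ?L d) x)"
      using B x L sc[OF d] by (simp add: E_scaleK E_Int)
    moreover have "B \<inter> ?L d = (if d = c then B else {})"
      using B(2) by auto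
    ultimately show "E B (scaleK d (E (?L d) x)) = (if d = c then scaleK c (E B x) else 0)"
      using x sc[OF d] by simp
  qed
  also have "\<dots> = scaleK c (E B x)"
    using True scalar_simple_finite[OF s] by simp
  finally show ?thesis .
next
  case False
  then have "B = {}" using B(2) by auto
  then show ?thesis using x c spectral_sum_in[OF s x] by simp
qed

text \<open>On a joint level set of \<open>s\<close> and \<open>s'\<close> the difference acts as a
  single scalar, which has modulus at most \<open>e\<close> unless the level set is null; Pythagoras
  adds up the pieces.\<close>

lemma norm_E_spectral_sum_diff_le:
  assumes s: "scalar_simple s" "scalar_simple s'" and B: "B \<in> sets N" and x: "x \<in> V" and e: "0 \<le> e"
    and null: "null {t \<in> B. e < norm (s t - s' t)}"
  shows "norm (E B (spectral_sum N E s x - spectral_sum N E s' x)) \<le> e * norm (E B x)"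
proof -
  define p where "p = spectral_sum N E s x - spectral_sum N E s' x"
  have p: "p \<in> V"
    unfolding p_def using s x by (intro closed_subspace_diff[OF subspace] spectral_sum_in)
  have BN: "B \<subseteq> space N" using B by (rule sets.sets_into_space)
  define k where "k t = (s t, s' t)" for t
  define C where "C l = {t \<in> B. k t = l}" for l
  have C: "C l \<in> sets N" for l
  proof -
    have "C l = B \<inter> (s -` {fst l} \<inter> space N) \<inter> (s' -` {snd l} \<inter> space N)"
      using BN by (auto simp: C_def k_def)
    then show ?thesis using s B by (auto intro: scalar_simple_level)
  qed
  have "k ` B \<subseteq> s ` space N \<times> s' ` space N"
    using BN by (auto simp: k_def)
  then have fin: "finite (k ` B)"
    by (rule finite_subset) (intro finite_cartesian_product scalar_simple_finite s)
  have nullset: "{t \<in> B. e < norm (s t - s' t)} \<in> sets N"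
  proof -
    have [measurable]: "s \<in> borel_measurable N" "s' \<in> borel_measurable N"
      using s by (auto simp: scalar_simple_def intro: borel_measurable_simple_function)
    have "{t \<in> space N. e < norm (s t - s' t)} \<in> sets N"
      by measurable
    then have "B \<inter> {t \<in> space N. e < norm (s t - s' t)} \<in> sets N"
      using B by auto
    moreover have "B \<inter> {t \<in> space N. e < norm (s t - s' t)} = {t \<in> B. e < norm (s t - s' t)}"
      using BN by auto
    ultimately show ?thesis by simp
  qed
  have level: "(norm (E (C l) p))\<^sup>2 \<le> e\<^sup>2 * (norm (E (C l) x))\<^sup>2" if l: "l \<in> k ` B" for l
  proof -
    have sc: "fst l \<in> scalars TYPE('a)" "snd l \<in> scalars TYPE('a)"
      using l s BN by (auto simp: k_def scalar_simple_scalars)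
    have "E (C l) p = E (C l) (spectral_sum N E s x) - E (C l) (spectral_sum N E s' x)"
      unfolding p_def using C s x by (intro E_diff spectral_sum_in)
    also have "\<dots> = scaleK (fst l) (E (C l) x) - scaleK (snd l) (E (C l) x)"
    proof -
      have "C l \<subseteq> s -` {fst l} \<inter> space N" "C l \<subseteq> s' -` {snd l} \<inter> space N"
        using BN by (auto simp: C_def k_def)
      then show ?thesis
        using C s x sc by (simp only: E_spectral_sum)
    qed
    also have "\<dots> = scaleK (fst l - snd l) (E (C l) x)"
      using sc by (simp add: scaleK_diff_left)
    finally have *: "norm (E (C l) p) = norm (fst l - snd l) * norm (E (C l) x)"
      using sc by (simp add: norm_scaleK scalars_diff)
    show ?thesis
    proof (cases "norm (fst l - snd l) \<le> e")
      case True
      then show ?thesis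
        unfolding * power_mult_distrib by (intro mult_right_mono power_mono) auto
    next
      case False
      then have "C l \<subseteq> {t \<in> B. e < norm (s t - s' t)}"
        by (auto simp: C_def k_def)
      then have "E (C l) x = 0"
        using null_subset[OF null C nullset] x by (auto simp: spectral_null_def)
      then show ?thesis by (simp add: *)
    qed
  qed
  have "(norm (E B p))\<^sup>2 = (\<Sum>l\<in>k ` B. (norm (E (C l) p))\<^sup>2)"
    using additive_on_level_sets[OF additive_on_norm_E[OF p] fin] C by (simp add: C_def)
  also have "\<dots> \<le> (\<Sum>l\<in>k ` B. e\<^sup>2 * (norm (E (C l) x))\<^sup>2)"
    by (rule sum_mono) (rule level)
  also have "\<dots> = (e * norm (E B x))\<^sup>2"
    using additive_on_level_sets[OF additive_on_norm_E[OF x] fin] C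
    by (simp add: C_def power_mult_distrib sum_distrib_left)
  finally show ?thesis
    unfolding p_def by (rule power2_le_imp_le) (use e in simp)
qed

text \<open>The admissibility conditions in \<open>spectral_integral\<close>, separated from the
  limit, so that existence and uniqueness of the limit can be proved for given sequences.\<close>

definition approximates :: "(nat \<Rightarrow> real \<Rightarrow> complex) \<Rightarrow> (real \<Rightarrow> complex) \<Rightarrow> bool" where
  "approximates s g \<longleftrightarrow> (\<forall>n. scalar_simple (s n)) \<and>
    (\<forall>e>0. \<forall>\<^sub>F n in sequentially. null {t \<in> space N. e < norm (s n t - g t)})"

lemma L_infinityD:
  assumes "g \<in> L_infinity V N E"
  shows "g \<in> borel_measurable N" "\<And>t. t \<in> space N \<Longrightarrow> g t \<in> scalars TYPE('a)"
    "\<exists>C. null {t \<in> space N. C < norm (g t)}"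
  using assms by (auto simp: L_infinity_def)

lemma grid_approximation:
  assumes h: "h > 0"
  shows "norm (of_real (h * \<lfloor>Re z / h\<rfloor>) + \<i> * of_real (h * \<lfloor>Im z / h\<rfloor>) - z) \<le> 2 * h"
proof -
  have *: "\<bar>h * \<lfloor>x / h\<rfloor> - x\<bar> \<le> h" for x
  proof -
    have "\<bar>\<lfloor>x / h\<rfloor> - x / h\<bar> \<le> 1" by linarith
    then have "h * \<bar>\<lfloor>x / h\<rfloor> - x / h\<bar> \<le> h" using h by simp
    also have "h * \<bar>\<lfloor>x / h\<rfloor> - x / h\<bar> = \<bar>h * (\<lfloor>x / h\<rfloor> - x / h)\<bar>" using h by (simp add: abs_mult)
    finally show ?thesis using h by (simp add: right_diff_distrib)
  qed
  show ?thesis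
    using cmod_le[of "of_real (h * \<lfloor>Re z / h\<rfloor>) + \<i> * of_real (h * \<lfloor>Im z / h\<rfloor>) - z"]
      *[of "Re z"] *[of "Im z"]
    by simp
qed

lemma ex_approximates:
  assumes g: "g \<in> L_infinity V N E"
  shows "\<exists>s. approximates s g"
proof -
  note [measurable] = L_infinityD(1)[OF g]
  obtain C where C: "null {t \<in> space N. C < norm (g t)}"
    using L_infinityD(3)[OF g] by auto
  define r where "r h z = complex_of_real (h * \<lfloor>Re z / h\<rfloor>) + \<i> * of_real (h * \<lfloor>Im z / h\<rfloor>)" for h z
  \<comment> \<open>Values are rounded to a corner of their grid square, with error at most
    \<open>1 / Suc n\<close>. Where \<open>norm (g t)\<close> exceeds \<open>C\<close>, a null set,
    the value 0 keeps the range finite.\<close>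
  define s where "s n t = (if norm (g t) \<le> C then r (1 / (2 * real (Suc n))) (g t) else 0)" for n t
  have r_grid: "r h z = of_real (h * fst (grid h z)) + \<i> * of_real (h * snd (grid h z))" for h z
    by (simp add: r_def grid_def)
  have "scalar_simple (s n)" for n
  proof -
    let ?h = "1 / (2 * real (Suc n))"
    have "s n ` space N \<subseteq> insert 0 ((\<lambda>(i, j). of_real (?h * of_int i) + \<i> * of_real (?h * of_int j)) ` grid ?h ` cball 0 C)"
      by (auto simp: s_def r_grid split_beta)
    then have "finite (s n ` space N)"
      by (rule finite_subset) (intro finite.insertI finite_imageI finite_grid_image; simp)
    moreover have "s n \<in> borel_measurable N"
      unfolding s_def r_def by measurable
    ultimately have "simple_function N (s n)"
      by (simp add: simple_function_borel_measurable)
    moreover have "s n t \<in> scalars TYPE('a)" if "t \<in> space N" for t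
      using scalars_cases[where 'a='a]
    proof (elim disjE)
      \<comment> \<open>Over the reals the imaginary parts vanish, so the chosen corners are real as
        well.\<close>
      assume R: "scalars TYPE('a) = \<real>"
      then have "Im (g t) = 0"
        using L_infinityD(2)[OF g that] by (simp add: complex_is_Real_iff)
      then show ?thesis using R by (simp add: s_def r_def)
    qed simp
    ultimately show ?thesis by (auto simp: scalar_simple_def)
  qed
  moreover have "\<forall>\<^sub>F n in sequentially. null {t \<in> space N. e < norm (s n t - g t)}" if e: "e > 0" for e
  proof -
    have "(\<lambda>n. 1 / real (Suc n)) \<longlonglongrightarrow> 0" by (rule LIMSEQ_Suc[OF lim_1_over_n])
    then have "\<forall>\<^sub>F n in sequentially. 1 / real (Suc n) < e"
      using e by (rule order_tendstoD)
    then show ?thesis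
    proof eventually_elim
      case (elim n)
      have "norm (s n t - g t) \<le> 1 / real (Suc n)" if "norm (g t) \<le> C" for t
      proof -
        have "s n t = r (1 / (2 * real (Suc n))) (g t)"
          using that by (simp only: s_def if_True)
        moreover have "2 * (1 / (2 * real (Suc n))) = 1 / real (Suc n)"
          by (simp add: field_simps)
        ultimately show ?thesis
          using grid_approximation[of "1 / (2 * real (Suc n))" "g t"] by (simp add: r_def)
      qed
      then have "{t \<in> space N. e < norm (s n t - g t)} \<subseteq> {t \<in> space N. C < norm (g t)}"
        using elim by (smt (verit) Collect_mono)
      moreover have "{t \<in> space N. e < norm (s n t - g t)} \<in> sets N"
        unfolding s_def r_def by measurable
      moreover have "{t \<in> space N. C < norm (g t)} \<in> sets N"
        by measurable
      ultimately show ?case using null_subset[OF C] by blast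
    qed
  qed
  ultimately show ?thesis by (auto simp: approximates_def)
qed

text \<open>Two sequences are allowed: taking them equal gives the Cauchy property, taking them
  different shows that the limit does not depend on the choice.\<close>

lemma approximates_close:
  assumes g: "g \<in> L_infinity V N E" and s: "approximates s g" "approximates s' g"
    and x: "x \<in> V" and e: "e > 0"
  shows "\<exists>n0. \<forall>n\<ge>n0. \<forall>m\<ge>n0. norm (spectral_sum N E (s n) x - spectral_sum N E (s' m) x) \<le> e"
proof -
  note [measurable] = L_infinityD(1)[OF g]
  \<comment> \<open>The summand 1 avoids a division by zero when \<open>x = 0\<close>; the 2 in
    \<open>d\<close> pays for the two approximations of \<open>g\<close>.\<close>
  define a where "a = norm x + 1"
  define d where "d = e / (2 * a)"
  have a: "a > 0" "norm x \<le> a" by (auto simp: a_def add_nonneg_pos)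
  then have d0: "d > 0" using e by (simp add: d_def)
  have "2 * d * norm x \<le> 2 * d * a"
    using a d0 by (intro mult_left_mono) auto
  also have "\<dots> = e" using a by (simp add: d_def)
  finally have d: "d > 0" "2 * d * norm x \<le> e" using d0 by auto
  have sm: "s n \<in> borel_measurable N" "s' n \<in> borel_measurable N"
    and ss: "scalar_simple (s n)" "scalar_simple (s' n)" for n
    using s by (auto simp: approximates_def scalar_simple_def intro: borel_measurable_simple_function)
  note [measurable] = sm
  have "\<forall>\<^sub>F n in sequentially. null {t \<in> space N. d < norm (s n t - g t)}"
    "\<forall>\<^sub>F n in sequentially. null {t \<in> space N. d < norm (s' n t - g t)}"
    using s d(1) by (auto simp: approximates_def)
  then have "\<forall>\<^sub>F n in sequentially. null {t \<in> space N. d < norm (s n t - g t)} \<and>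
      null {t \<in> space N. d < norm (s' n t - g t)}"
    by eventually_elim auto
  then obtain n0 where n0: "\<And>n. n \<ge> n0 \<Longrightarrow> null {t \<in> space N. d < norm (s n t - g t)}"
    "\<And>n. n \<ge> n0 \<Longrightarrow> null {t \<in> space N. d < norm (s' n t - g t)}"
    by (auto simp: eventually_sequentially)
  have "norm (spectral_sum N E (s n) x - spectral_sum N E (s' m) x) \<le> e" if "n \<ge> n0" "m \<ge> n0" for n m
  proof -
    let ?A = "{t \<in> space N. d < norm (s n t - g t)}" and ?B = "{t \<in> space N. d < norm (s' m t - g t)}"
    have m: "?A \<in> sets N" "?B \<in> sets N" "{t \<in> space N. 2 * d < norm (s n t - s' m t)} \<in> sets N"
      by measurable
    have sub: "{t \<in> space N. 2 * d < norm (s n t - s' m t)} \<subseteq> ?A \<union> ?B"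
    proof safe
      fix t assume "2 * d < norm (s n t - s' m t)" "\<not> d < norm (s' m t - g t)"
      then show "d < norm (s n t - g t)"
        using norm_triangle_ineq4[of "s n t - g t" "s' m t - g t"] by simp
    qed
    have "null (?A \<union> ?B)"
      by (rule null_Un[OF m(1,2) n0(1)[OF that(1)] n0(2)[OF that(2)]])
    then have "null {t \<in> space N. 2 * d < norm (s n t - s' m t)}"
      by (rule null_subset[OF _ m(3) sets.Un[OF m(1,2)] sub])
    then have "norm (E (space N) (spectral_sum N E (s n) x - spectral_sum N E (s' m) x)) \<le>
        2 * d * norm (E (space N) x)"
      using ss x d by (intro norm_E_spectral_sum_diff_le) auto
    then show ?thesis
      using ss x d closed_subspace_diff[OF subspace spectral_sum_in spectral_sum_in] by simp
  qed
  then show ?thesis by blast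
qed

text \<open>This justifies the definite description: completeness supplies a limit, and
  \<open>approximates_close\<close> makes it unique.\<close>

lemma spectral_integral_tendsto:
  assumes g: "g \<in> L_infinity V N E" and s: "approximates s g" and x: "x \<in> V"
  shows "(\<lambda>n. spectral_sum N E (s n) x) \<longlonglongrightarrow> spectral_integral V N E g x"
proof -
  have "Cauchy (\<lambda>n. spectral_sum N E (s n) x)"
  proof (rule CauchyI)
    fix e :: real assume "0 < e"
    then obtain n0 where "\<forall>n\<ge>n0. \<forall>m\<ge>n0. norm (spectral_sum N E (s n) x - spectral_sum N E (s m) x) \<le> e / 2"
      using approximates_close[OF g s s x, of "e / 2"] by auto
    with \<open>0 < e\<close> show "\<exists>M. \<forall>m\<ge>M. \<forall>n\<ge>M. norm (spectral_sum N E (s m) x - spectral_sum N E (s n) x) < e"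
      by (intro exI[of _ n0]) (smt (verit) field_sum_of_halves)
  qed
  then obtain y where y: "(\<lambda>n. spectral_sum N E (s n) x) \<longlonglongrightarrow> y"
    using Cauchy_convergent_iff convergent_def by blast
  have "spectral_integral V N E g x = y"
    unfolding spectral_integral_def
  proof (rule the_equality, goal_cases)
    case 1
    show ?case
      using s y by (intro exI[of _ s]) (auto simp: approximates_def scalar_simple_def)
  next
    case (2 y')
    then obtain s' where s': "approximates s' g" and y': "(\<lambda>n. spectral_sum N E (s' n) x) \<longlonglongrightarrow> y'"
      by (auto simp: approximates_def scalar_simple_def)
    have "norm (y' - y) \<le> e" if "e > 0" for e
    proof -
      obtain n0 where "\<forall>n\<ge>n0. \<forall>m\<ge>n0. norm (spectral_sum N E (s' n) x - spectral_sum N E (s m) x) \<le> e"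
        using approximates_close[OF g s' s x \<open>e > 0\<close>] by auto
      then show ?thesis
        by (intro tendsto_upperbound[OF tendsto_norm[OF tendsto_diff[OF y' y]]])
           (auto simp: eventually_sequentially)
    qed
    then have "norm (y' - y) \<le> 0" by (rule field_le_epsilon[where y="0::real", simplified])
    then show ?case by simp
  qed
  with y show ?thesis by simp
qed

lemma spectral_integral_in:
  assumes g: "g \<in> L_infinity V N E" and x: "x \<in> V"
  shows "spectral_integral V N E g x \<in> V"
proof -
  obtain s where s: "approximates s g" using ex_approximates[OF g] by auto
  then have "spectral_sum N E (s n) x \<in> V" for n
    using x by (auto simp: approximates_def intro: spectral_sum_in)
  then show ?thesis
    by (rule closed_sequentially[OF closed_subspace_closed[OF subspace] _ spectral_integral_tendsto[OF g s x]])
qed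

lemma spectral_integral_scaleR:
  assumes g: "g \<in> L_infinity V N E" and x: "x \<in> V"
  shows "spectral_integral V N E g (r *\<^sub>R x) = r *\<^sub>R spectral_integral V N E g x"
proof -
  obtain s where s: "approximates s g" using ex_approximates[OF g] by auto
  have "(\<lambda>n. r *\<^sub>R spectral_sum N E (s n) x) \<longlonglongrightarrow> spectral_integral V N E g (r *\<^sub>R x)"
    using spectral_integral_tendsto[OF g s closed_subspace_scaleR[OF subspace x, of r]] s x
    by (simp add: approximates_def spectral_sum_scaleR)
  then show ?thesis
    using tendsto_scaleR[OF tendsto_const spectral_integral_tendsto[OF g s x]]
    by (rule LIMSEQ_unique)
qed

text \<open>The local form of the functional calculus: where \<open>g\<close> is nearly constant,
  its integral is nearly a scalar. Together with membership in \<open>V\<close> and real homogeneity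
  this is what the block estimates use.\<close>

lemma norm_E_spectral_integral_diff_le:
  assumes g: "g \<in> L_infinity V N E" and x: "x \<in> V" and B: "B \<in> sets N" and c: "c \<in> scalars TYPE('a)"
    and d: "0 \<le> d" "\<And>t. t \<in> B \<Longrightarrow> norm (g t - c) \<le> d"
  shows "norm (E B (spectral_integral V N E g x) - scaleK c (E B x)) \<le> d * norm (E B x)"
proof -
  note [measurable] = L_infinityD(1)[OF g]
  obtain s where s: "approximates s g" using ex_approximates[OF g] by auto
  have ss: "scalar_simple (s n)" for n
    using s by (auto simp: approximates_def)
  then have [measurable]: "s n \<in> borel_measurable N" for n
    by (auto simp: scalar_simple_def intro: borel_measurable_simple_function)
  have BN: "B \<subseteq> space N" using B by (rule sets.sets_into_space)
  let ?F = "spectral_integral V N E g x"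
  have "(\<lambda>n. E B (spectral_sum N E (s n) x)) \<longlonglongrightarrow> E B ?F"
  proof (rule LIM_zero_cancel, rule Lim_null_comparison)
    show "\<forall>\<^sub>F n in sequentially. norm (E B (spectral_sum N E (s n) x) - E B ?F) \<le>
        norm (spectral_sum N E (s n) x - ?F)"
      using B x ss g
      by (simp add: E_diff[symmetric] spectral_sum_in spectral_integral_in norm_E_le
            closed_subspace_diff[OF subspace])
    show "(\<lambda>n. norm (spectral_sum N E (s n) x - ?F)) \<longlonglongrightarrow> 0"
      using spectral_integral_tendsto[OF g s x] by (simp add: tendsto_norm_zero LIM_zero)
  qed
  then have lim: "(\<lambda>n. norm (E B (spectral_sum N E (s n) x) - scaleK c (E B x))) \<longlonglongrightarrow>
      norm (E B ?F - scaleK c (E B x))"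
    by (intro tendsto_intros)
  \<comment> \<open>Off a null set \<open>s n\<close> is within \<open>e\<close> of
    \<open>g\<close>, hence within \<open>d + e\<close> of \<open>c\<close> on \<open>B\<close>, and
    can be compared with the constant simple function \<open>c\<close>. Then \<open>e\<close> tends
    to 0.\<close>
  have bound: "norm (E B ?F - scaleK c (E B x)) \<le> (d + e) * norm (E B x)" if e: "e > 0" for e
  proof (rule tendsto_upperbound[OF lim])
    have "\<forall>\<^sub>F n in sequentially. null {t \<in> space N. e < norm (s n t - g t)}"
      using s e by (auto simp: approximates_def)
    then show "\<forall>\<^sub>F n in sequentially. norm (E B (spectral_sum N E (s n) x) - scaleK c (E B x)) \<le>
        (d + e) * norm (E B x)"
    proof eventually_elim
      case (elim n)
      have "{t \<in> B. d + e < norm (s n t - c)} \<subseteq> {t \<in> space N. e < norm (s n t - g t)}"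
      proof safe
        fix t assume t: "t \<in> B" "d + e < norm (s n t - c)"
        then show "e < norm (s n t - g t)"
          using norm_triangle_ineq[of "s n t - g t" "g t - c"] d(2)[of t] by simp
      qed (use BN in auto)
      moreover have "{t \<in> B. d + e < norm (s n t - c)} = B \<inter> {t \<in> space N. d + e < norm (s n t - c)}"
        using BN by auto
      then have "{t \<in> B. d + e < norm (s n t - c)} \<in> sets N"
        using B by simp
      moreover have "{t \<in> space N. e < norm (s n t - g t)} \<in> sets N"
        by measurable
      ultimately have "null {t \<in> B. d + e < norm (s n t - c)}"
        using null_subset[OF elim] by blast
      then have "norm (E B (spectral_sum N E (s n) x - spectral_sum N E (\<lambda>_. c) x)) \<le> (d + e) * norm (E B x)"
        using B x ss c d e by (intro norm_E_spectral_sum_diff_le scalar_simple_const) auto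
      moreover have "E B (spectral_sum N E (\<lambda>_. c) x) = scaleK c (E B x)"
        using B BN x c by (intro E_spectral_sum scalar_simple_const) auto
      ultimately show ?case
        using B x ss c by (simp add: E_diff spectral_sum_in scalar_simple_const)
    qed
  qed simp
  show ?thesis
  proof (rule tendsto_lowerbound)
    show "((\<lambda>e. (d + e) * norm (E B x)) \<longlongrightarrow> d * norm (E B x)) (at_right 0)"
      by (auto intro!: tendsto_eq_intros)
    show "\<forall>\<^sub>F e in at_right 0. norm (E B ?F - scaleK c (E B x)) \<le> (d + e) * norm (E B x)"
      by (rule eventually_mono[OF eventually_at_right_less]) (rule bound)
  qed simp
qed

end

section \<open>Block operators over a projection-valued measure\<close>

context pvm begin

text \<open>The essential bound \<open>C\<close> makes the infimum range over a nonempty set. The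
  infimum is attained, since the set above it is a countable union of null sets.\<close>

lemma ess_sup_nonneg: "null {t \<in> space N. C < g t} \<Longrightarrow> g \<in> borel_measurable N \<Longrightarrow> 0 \<le> ess_sup V N E g"
  and null_above_ess_sup:
    "null {t \<in> space N. C < g t} \<Longrightarrow> g \<in> borel_measurable N \<Longrightarrow> null {t \<in> space N. ess_sup V N E g < g t}"
proof -
  assume C: "null {t \<in> space N. C < g t}" and [measurable]: "g \<in> borel_measurable N"
  define A where "A = {c. 0 \<le> c \<and> null {t \<in> space N. c < g t}}"
  have "null {t \<in> space N. max 0 C < g t}"
    by (rule null_subset[OF C]) auto
  then have A: "A \<noteq> {}" "bdd_below A"
    by (auto simp: A_def intro!: exI[of _ "max 0 C"] bdd_belowI[of _ 0])
  have eq: "ess_sup V N E g = Inf A" by (simp add: ess_sup_def A_def)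
  show "0 \<le> ess_sup V N E g"
    unfolding eq using A by (intro cInf_greatest) (auto simp: A_def)
  have "null {t \<in> space N. Inf A + 1 / Suc n < g t}" for n
  proof -
    obtain c where c: "c \<in> A" "c < Inf A + 1 / Suc n"
      using A cInf_lessD[of A "Inf A + 1 / Suc n"] by auto
    then have "null {t \<in> space N. c < g t}" by (simp add: A_def)
    then show ?thesis
      by (rule null_subset) (use c in auto)
  qed
  then have "null (\<Union>n. {t \<in> space N. Inf A + 1 / Suc n < g t})"
    by (intro null_countable_UN) measurable
  also have "(\<Union>n. {t \<in> space N. Inf A + 1 / Suc n < g t}) = {t \<in> space N. Inf A < g t}"
  proof safe
    fix t assume "Inf A < g t" "t \<in> space N"
    then obtain n where "1 / Suc n < g t - Inf A"
      using nat_approx_posE[of "g t - Inf A"] by (auto simp: inverse_eq_divide)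
    then show "t \<in> (\<Union>n. {t \<in> space N. Inf A + 1 / Suc n < g t})"
      using \<open>t \<in> space N\<close> by (auto intro!: exI[of _ n])
  qed (smt (verit) of_nat_0_le_iff zero_le_divide_1_iff)
  finally show "null {t \<in> space N. ess_sup V N E g < g t}" by (simp add: eq)
qed

lemma not_null_above:
  assumes "0 \<le> c" "c < ess_sup V N E g"
  shows "\<not> null {t \<in> space N. c < g t}"
proof
  assume "null {t \<in> space N. c < g t}"
  then have "Inf {c. 0 \<le> c \<and> null {t \<in> space N. c < g t}} \<le> c"
    using assms(1) by (intro cInf_lower) (auto intro: bdd_belowI[of _ 0])
  then show False using assms(2) by (simp add: ess_sup_def)
qed

text \<open>Reconciles \<open>lambda_max\<close>, an essential supremum of
  \<open>psi f t / 2\<close>, with \<open>Sigma_max\<close>, which refers to that of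
  \<open>psi f\<close>.\<close>

lemma ess_sup_half:
  assumes C: "null {t \<in> space N. C < g t}" and g [measurable]: "g \<in> borel_measurable N"
  shows "ess_sup V N E g = 2 * ess_sup V N E (\<lambda>t. g t / 2)"
proof -
  have C': "null {t \<in> space N. C / 2 < g t / 2}" using C by simp
  have g': "(\<lambda>t. g t / 2) \<in> borel_measurable N" by measurable
  note n = ess_sup_nonneg[OF C g] ess_sup_nonneg[OF C' g']
  have "\<not> ess_sup V N E g < 2 * ess_sup V N E (\<lambda>t. g t / 2)"
    using not_null_above[of "ess_sup V N E g / 2" "\<lambda>t. g t / 2"] n null_above_ess_sup[OF C g] by auto
  moreover have "\<not> 2 * ess_sup V N E (\<lambda>t. g t / 2) < ess_sup V N E g"
    using not_null_above[of "2 * ess_sup V N E (\<lambda>t. g t / 2)" g] n null_above_ess_sup[OF C' g']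
    by (auto simp: field_simps)
  ultimately show ?thesis by simp
qed

end

section \<open>Upper and lower estimates for the block over a measurable set\<close>

locale block = pvm V N E
  for V :: "'a::hilbert set" and N :: "real measure" and E :: "real set \<Rightarrow> 'a \<Rightarrow> 'a" +
  fixes f :: "nat \<Rightarrow> nat \<Rightarrow> real \<Rightarrow> complex"
  assumes entry: "\<And>i j. i < 2 \<Longrightarrow> j < 2 \<Longrightarrow> f i j \<in> L_infinity V N E"
begin

abbreviation calc :: "(real \<Rightarrow> complex) \<Rightarrow> 'a \<Rightarrow> 'a" where
  "calc \<equiv> spectral_integral V N E"

text \<open>The pair \<open>(row 0 x y, row 1 x y)\<close> is the block applied to
  \<open>(x, y)\<close>, both summands being read in \<open>V\<close>.\<close>

definition row :: "nat \<Rightarrow> 'a \<Rightarrow> 'a \<Rightarrow> 'a" where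
  "row i x y = calc (f i 0) x + calc (f i 1) y"

lemma entry_measurable [measurable]: "i < 2 \<Longrightarrow> j < 2 \<Longrightarrow> f i j \<in> borel_measurable N"
  by (rule L_infinityD(1)[OF entry])

lemma entry_scalars: "i < 2 \<Longrightarrow> j < 2 \<Longrightarrow> t \<in> space N \<Longrightarrow> f i j t \<in> scalars TYPE('a)"
  by (rule L_infinityD(2)[OF entry])

lemma gram00_measurable [measurable]: "gram00 f \<in> borel_measurable N"
  and gram01_measurable [measurable]: "gram01 f \<in> borel_measurable N"
  and psi_measurable [measurable]: "psi f \<in> borel_measurable N"
proof -
  have [measurable]: "f 0 0 \<in> borel_measurable N" "f 0 1 \<in> borel_measurable N"
    "f 1 0 \<in> borel_measurable N" "f 1 1 \<in> borel_measurable N"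
    by simp_all
  have [measurable]: "(\<lambda>t. cnj (g t)) \<in> borel_measurable N" if "g \<in> borel_measurable N" for g
    using that by (rule measurable_compose)
      (intro borel_measurable_continuous_onI continuous_on_cnj continuous_on_id)
  have 0: "(\<lambda>t. gram00 f t) \<in> borel_measurable N" "(\<lambda>t. gram11 f t) \<in> borel_measurable N"
    "(\<lambda>t. gram01 f t) \<in> borel_measurable N"
    unfolding gram00_def gram11_def gram01_def by measurable
  then show "gram00 f \<in> borel_measurable N" "gram01 f \<in> borel_measurable N" by simp_all
  note [measurable] = 0
  have "(\<lambda>t. psi f t) \<in> borel_measurable N"
    unfolding psi_eq_gram by measurable
  then show "psi f \<in> borel_measurable N" by simp
qed

lemma row_in: "i < 2 \<Longrightarrow> x \<in> V \<Longrightarrow> y \<in> V \<Longrightarrow> row i x y \<in> V"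
  unfolding row_def by (intro closed_subspace_add[OF subspace] spectral_integral_in entry) auto

lemma row_scaleR: "i < 2 \<Longrightarrow> x \<in> V \<Longrightarrow> y \<in> V \<Longrightarrow> row i (r *\<^sub>R x) (r *\<^sub>R y) = r *\<^sub>R row i x y"
  by (simp add: row_def spectral_integral_scaleR entry scaleR_add_right)

text \<open>One co-null set serves all four entries: \<open>additive_nonneg_by_cells\<close> asks
  for pointwise bounds, whereas the entries are bounded only essentially.\<close>

lemma ex_essentially_bounded:
  obtains S C where "S \<in> sets N" "null (space N - S)" "0 \<le> C"
    "\<And>i j t. i < 2 \<Longrightarrow> j < 2 \<Longrightarrow> t \<in> S \<Longrightarrow> norm (f i j t) \<le> C"
proof -
  have "\<forall>i j. \<exists>C. i < 2 \<longrightarrow> j < 2 \<longrightarrow> null {t \<in> space N. C < norm (f i j t)}"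
    using L_infinityD(3)[OF entry] by blast
  then obtain c where c: "\<And>i j. i < 2 \<Longrightarrow> j < 2 \<Longrightarrow> null {t \<in> space N. c i j < norm (f i j t)}"
    by metis
  let ?T = "\<lambda>i j. {t \<in> space N. c i j < norm (f i j t)}"
  define S where "S = space N - (?T 0 0 \<union> ?T 0 1 \<union> ?T 1 0 \<union> ?T 1 1)"
  have T: "?T i j \<in> sets N" if "i < 2" "j < 2" for i j
    using that by measurable
  have "null (?T 0 0 \<union> ?T 0 1 \<union> ?T 1 0 \<union> ?T 1 1)"
    by (intro null_Un sets.Un T c) simp_all
  moreover have "space N - S = ?T 0 0 \<union> ?T 0 1 \<union> ?T 1 0 \<union> ?T 1 1"
    by (auto simp: S_def)
  ultimately have "null (space N - S)" by simp
  moreover have "S \<in> sets N"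
    unfolding S_def by (intro sets.Diff sets.top sets.Un T) simp_all
  moreover have "norm (f i j t) \<le> \<bar>c 0 0\<bar> + \<bar>c 0 1\<bar> + \<bar>c 1 0\<bar> + \<bar>c 1 1\<bar>"
    if "i < 2" "j < 2" "t \<in> S" for i j t
    using that by (auto simp: S_def less_2_cases_iff)
  ultimately show ?thesis
    by (intro that[of S "\<bar>c 0 0\<bar> + \<bar>c 0 1\<bar> + \<bar>c 1 0\<bar> + \<bar>c 1 1\<bar>"]) auto
qed

lemma psi_essentially_bounded: "\<exists>C. null {t \<in> space N. C < psi f t}"
proof -
  obtain S C where S: "S \<in> sets N" "null (space N - S)" "0 \<le> C"
    "\<And>i j t. i < 2 \<Longrightarrow> j < 2 \<Longrightarrow> t \<in> S \<Longrightarrow> norm (f i j t) \<le> C"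
    using ex_essentially_bounded by blast
  \<comment> \<open>\<open>phi\<close> has four terms of size at most \<open>C\<^sup>2\<close>, and
    \<open>psi\<close> is at most twice \<open>phi\<close>.\<close>
  have "psi f t \<le> 8 * C\<^sup>2" if "t \<in> S" for t
  proof -
    have "phi f t \<le> (\<Sum>i<2::nat. \<Sum>j<2::nat. C\<^sup>2)"
      unfolding phi_def using S(4) that by (intro sum_mono power_mono) auto
    then show ?thesis using psi_le_2_phi[of f t] by simp
  qed
  then have "{t \<in> space N. 8 * C\<^sup>2 < psi f t} \<subseteq> space N - S" by force
  then have "null {t \<in> space N. 8 * C\<^sup>2 < psi f t}"
    using S by (intro null_subset[OF S(2)]) auto
  then show ?thesis by blast
qed

text \<open>Freezing the entries at a point \<open>t\<close> of a cell with small oscillation turns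
  the operator row into a numerical one, with an error proportional to the part of
  \<open>(x, y)\<close> over the cell.\<close>

lemma norm_E_row_diff_le:
  assumes x: "x \<in> V" "y \<in> V" and B: "B \<in> sets N" "t \<in> B" and i: "i < 2" and d: "0 \<le> d"
    and osc: "\<And>j s. j < 2 \<Longrightarrow> s \<in> B \<Longrightarrow> norm (f i j s - f i j t) \<le> d"
  shows "norm (E B (row i x y) - (scaleK (f i 0 t) (E B x) + scaleK (f i 1 t) (E B y))) \<le>
    d * (norm (E B x) + norm (E B y))"
proof -
  have t: "t \<in> space N" using B sets.sets_into_space by auto
  have "E B (row i x y) = E B (calc (f i 0) x) + E B (calc (f i 1) y)"
    unfolding row_def using x B i by (intro E_add spectral_integral_in entry) auto
  then have "E B (row i x y) - (scaleK (f i 0 t) (E B x) + scaleK (f i 1 t) (E B y)) =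
      (E B (calc (f i 0) x) - scaleK (f i 0 t) (E B x)) + (E B (calc (f i 1) y) - scaleK (f i 1 t) (E B y))"
    by simp
  also have "norm \<dots> \<le> d * norm (E B x) + d * norm (E B y)"
    using x B i t d osc
    by (intro order_trans[OF norm_triangle_ineq] add_mono norm_E_spectral_integral_diff_le entry
          entry_scalars) auto
  finally show ?thesis by (simp add: distrib_left)
qed

lemma norm_E_block_le:
  assumes S: "S \<in> sets N" and c: "0 \<le> c" "\<And>t. t \<in> S \<Longrightarrow> psi f t / 2 \<le> c" and x: "x \<in> V" "y \<in> V"
  shows "(norm (E S (row 0 x y)))\<^sup>2 + (norm (E S (row 1 x y)))\<^sup>2 \<le>
    c * ((norm (E S x))\<^sup>2 + (norm (E S y))\<^sup>2)"
proof -
  obtain T C where T: "T \<in> sets N" "null (space N - T)" "0 \<le> C"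
    "\<And>i j t. i < 2 \<Longrightarrow> j < 2 \<Longrightarrow> t \<in> T \<Longrightarrow> norm (f i j t) \<le> C"
    using ex_essentially_bounded by blast
  have ST: "S \<inter> T \<in> sets N" using S T by auto
  have EST: "E (S \<inter> T) z = E S z" if "z \<in> V" for z
    using that S T by (simp add: E_Int E_compl_null)
  have r: "row 0 x y \<in> V" "row 1 x y \<in> V" using x by (auto intro: row_in)
  define \<mu> where "\<mu> B = (norm (E B x))\<^sup>2 + (norm (E B y))\<^sup>2" for B
  define \<nu> where "\<nu> B = c * \<mu> B - ((norm (E B (row 0 x y)))\<^sup>2 + (norm (E B (row 1 x y)))\<^sup>2)" for B
  have \<mu>: "additive_on N \<mu>"
    unfolding \<mu>_def using x by (intro additive_on_add additive_on_norm_E)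
  have \<nu>: "additive_on N \<nu>"
    unfolding \<nu>_def using r by (intro additive_on_diff additive_on_mult \<mu> additive_on_add additive_on_norm_E)
  have "0 \<le> \<nu> (S \<inter> T)"
  \<comment> \<open>\<open>K\<close> comes from squaring \<open>sqrt c + 4 * \<delta>\<close>: for
    \<open>\<delta> \<le> 1\<close> the result is at most
    \<open>c + (8 * sqrt c + 16) * \<delta>\<close>.\<close>
  proof (rule additive_nonneg_by_cells[OF ST \<nu> \<mu>,
      where gs = "[f 0 0, f 0 1, f 1 0, f 1 1]" and K = "8 * sqrt c + 16"])
    show "set [f 0 0, f 0 1, f 1 0, f 1 1] \<subseteq> borel_measurable N" by auto
    show "norm (g t) \<le> C" if "g \<in> set [f 0 0, f 0 1, f 1 0, f 1 1]" "t \<in> S \<inter> T" for g t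
      using that T(4) by auto
    fix \<delta> B t
    assume \<delta>: "0 < \<delta>" "\<delta> \<le> (1::real)" and B: "B \<in> sets N" "B \<subseteq> S \<inter> T" and t: "t \<in> B"
      and osc: "\<And>g s. g \<in> set [f 0 0, f 0 1, f 1 0, f 1 1] \<Longrightarrow> s \<in> B \<Longrightarrow> norm (g s - g t) \<le> \<delta>"
    have tN: "t \<in> space N" using t B sets.sets_into_space by auto
    have osc': "norm (f i j s - f i j t) \<le> \<delta>" if "i < 2" "j < 2" "s \<in> B" for i j s
      using osc[of "f i j" s] that by (auto simp: less_2_cases_iff)
    define u v where "u = E B x" and "v = E B y"
    define X where "X = (E B (row 0 x y), E B (row 1 x y))"
    define Y where "Y = (scaleK (f 0 0 t) u + scaleK (f 0 1 t) v, scaleK (f 1 0 t) u + scaleK (f 1 1 t) v)"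
    define r where "r = norm (u, v)"
    have r: "0 \<le> r" "norm u \<le> r" "norm v \<le> r" "r\<^sup>2 = (norm u)\<^sup>2 + (norm v)\<^sup>2"
      by (auto simp: r_def norm_Pair intro: real_le_rsqrt)
    have "norm (X - Y) \<le> \<delta> * (norm u + norm v) + \<delta> * (norm u + norm v)"
      unfolding X_def Y_def diff_Pair u_def v_def
      using x B t \<delta> osc'
      by (intro order_trans[OF norm_Pair_le_add] add_mono norm_E_row_diff_le) auto
    also have "\<dots> = 2 * \<delta> * (norm u + norm v)" by simp
    also have "\<dots> \<le> 2 * \<delta> * (2 * r)"
      using r \<delta> by (intro mult_left_mono) auto
    also have "\<dots> = 4 * \<delta> * r" by simp
    finally have XY: "norm (X - Y) \<le> 4 * \<delta> * r" .
    have "(norm Y)\<^sup>2 \<le> psi f t / 2 * r\<^sup>2"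
      unfolding Y_def norm_Pair_power2 r(4) using entry_scalars tN
      by (intro norm_matrix_apply_le) auto
    also have "\<dots> \<le> c * r\<^sup>2"
      using c(2)[of t] t B by (intro mult_right_mono) auto
    also have "\<dots> = (sqrt c * r)\<^sup>2" using c by (simp add: power_mult_distrib)
    finally have "norm Y \<le> sqrt c * r"
      by (rule power2_le_imp_le) (use c r in simp)
    then have "norm X \<le> (sqrt c + 4 * \<delta>) * r"
      using XY norm_triangle_ineq[of Y "X - Y"] by (simp add: algebra_simps)
    then have "(norm X)\<^sup>2 \<le> ((sqrt c + 4 * \<delta>) * r)\<^sup>2"
      by (rule power_mono) simp
    also have "\<dots> = (c + 8 * sqrt c * \<delta> + 16 * (\<delta> * \<delta>)) * r\<^sup>2"
      using c by (simp add: power_mult_distrib power2_sum) (simp add: power2_eq_square algebra_simps)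
    also have "\<dots> \<le> (c + 8 * sqrt c * \<delta> + 16 * \<delta>) * r\<^sup>2"
      using \<delta> mult_left_le[of \<delta> \<delta>] by (intro mult_right_mono add_left_mono) auto
    finally have "(norm X)\<^sup>2 \<le> c * r\<^sup>2 + (8 * sqrt c + 16) * \<delta> * r\<^sup>2"
      by (simp add: algebra_simps)
    then show "- ((8 * sqrt c + 16) * \<delta> * \<mu> B) \<le> \<nu> B"
      by (simp add: \<nu>_def \<mu>_def X_def r(4) norm_Pair_power2 u_def v_def)
  qed
  then show ?thesis
    using x r by (simp add: \<nu>_def \<mu>_def EST)
qed

text \<open>A lower bound needs special vectors. Here \<open>x\<close> and \<open>y\<close> come
  from a single \<open>z\<close> through the fields \<open>v0\<close>, \<open>v1\<close>, so over a
  small cell \<open>(x, y)\<close> is nearly \<open>(v0 t, v1 t)\<close> times \<open>E B z\<close>,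
  and the pointwise hypothesis applies.\<close>

lemma norm_E_block_ge:
  assumes S: "S \<in> sets N" and z: "z \<in> V" and c: "0 \<le> c"
    and v: "v0 \<in> L_infinity V N E" "v1 \<in> L_infinity V N E"
    and bd: "0 \<le> C" "\<And>t. t \<in> S \<Longrightarrow> norm (v0 t) \<le> C" "\<And>t. t \<in> S \<Longrightarrow> norm (v1 t) \<le> C"
      "\<And>i j t. i < 2 \<Longrightarrow> j < 2 \<Longrightarrow> t \<in> S \<Longrightarrow> norm (f i j t) \<le> C"
    and ge: "\<And>t. t \<in> S \<Longrightarrow> c * ((norm (v0 t))\<^sup>2 + (norm (v1 t))\<^sup>2) \<le>
      (norm (f 0 0 t * v0 t + f 0 1 t * v1 t))\<^sup>2 + (norm (f 1 0 t * v0 t + f 1 1 t * v1 t))\<^sup>2"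
  defines "x \<equiv> calc v0 z" and "y \<equiv> calc v1 z"
  shows "c * ((norm (E S x))\<^sup>2 + (norm (E S y))\<^sup>2) \<le>
    (norm (E S (row 0 x y)))\<^sup>2 + (norm (E S (row 1 x y)))\<^sup>2"
proof -
  have x: "x \<in> V" "y \<in> V" using v z by (auto simp: x_def y_def intro: spectral_integral_in)
  have r: "row 0 x y \<in> V" "row 1 x y \<in> V" using x by (auto intro: row_in)
  \<comment> \<open>Errors are measured against \<open>z\<close> and not against
    \<open>(x, y)\<close>, because both fields may be small on a cell where \<open>E B z\<close> is
    not.\<close>
  define \<mu> where "\<mu> B = (norm (E B z))\<^sup>2" for B
  define \<nu> where "\<nu> B = ((norm (E B (row 0 x y)))\<^sup>2 + (norm (E B (row 1 x y)))\<^sup>2) -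
    c * ((norm (E B x))\<^sup>2 + (norm (E B y))\<^sup>2)" for B
  have \<mu>: "additive_on N \<mu>"
    unfolding \<mu>_def using z by (intro additive_on_norm_E)
  have \<nu>: "additive_on N \<nu>"
    unfolding \<nu>_def using r x by (intro additive_on_diff additive_on_mult additive_on_add additive_on_norm_E)
  let ?gs = "[f 0 0, f 0 1, f 1 0, f 1 1, v0, v1]"
  \<comment> \<open>\<open>8 * C + 4\<close> bounds the error of the image pair,
    \<open>2 * sqrt c\<close> that of \<open>(u, v)\<close> against the multiples of
    \<open>w\<close>. In \<open>K\<close> below, the further factor comes from
    \<open>r \<le> 2 * (C + 1) * n\<close>.\<close>
  define L where "L = 8 * C + 4 + 2 * sqrt c"
  have L: "0 \<le> L" using bd c by (simp add: L_def)
  have "0 \<le> \<nu> S"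
  proof (rule additive_nonneg_by_cells[OF S \<nu> \<mu>, where gs = ?gs and K = "4 * sqrt c * (C + 1) * L"])
    show "set ?gs \<subseteq> borel_measurable N" using v by (auto intro: L_infinityD)
    show "norm (g t) \<le> C" if "g \<in> set ?gs" "t \<in> S" for g t
      using that bd by auto
    fix \<delta> B t
    assume \<delta>: "0 < \<delta>" "\<delta> \<le> (1::real)" and B: "B \<in> sets N" "B \<subseteq> S" and t: "t \<in> B"
      and osc: "\<And>g s. g \<in> set ?gs \<Longrightarrow> s \<in> B \<Longrightarrow> norm (g s - g t) \<le> \<delta>"
    have tN: "t \<in> space N" and tS: "t \<in> S" using t B sets.sets_into_space by auto
    have osc': "norm (f i j s - f i j t) \<le> \<delta>" if "i < 2" "j < 2" "s \<in> B" for i j s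
      using osc[of "f i j" s] that by (auto simp: less_2_cases_iff)
    define w u v where "w = E B z" and "u = E B x" and "v = E B y"
    define n where "n = norm w"
    define a b where "a = v0 t" and "b = v1 t"
    have n: "0 \<le> n" by (simp add: n_def)
    have ab: "a \<in> scalars TYPE('a)" "b \<in> scalars TYPE('a)" "norm a \<le> C" "norm b \<le> C"
      using v tN tS bd by (auto simp: a_def b_def intro: L_infinityD)
    have uw: "norm (u - scaleK a w) \<le> \<delta> * n" and vw: "norm (v - scaleK b w) \<le> \<delta> * n"
      unfolding u_def v_def w_def n_def x_def y_def
      using v z B \<delta> osc ab by (intro norm_E_spectral_integral_diff_le; simp add: a_def b_def)+
    have un: "norm u \<le> (C + 1) * n" and vn: "norm v \<le> (C + 1) * n"
    proof -
      have "norm (scaleK a w) \<le> C * n" "norm (scaleK b w) \<le> C * n"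
        using ab n by (auto simp: norm_scaleK n_def[symmetric] intro: mult_right_mono)
      moreover have "\<delta> * n \<le> 1 * n" using \<delta> n by (intro mult_right_mono)
      ultimately show "norm u \<le> (C + 1) * n" "norm v \<le> (C + 1) * n"
        using uw vw norm_triangle_ineq[of "scaleK a w" "u - scaleK a w"]
          norm_triangle_ineq[of "scaleK b w" "v - scaleK b w"]
        by (simp_all add: distrib_right)
    qed
    define e where "e i = f i 0 t * a + f i 1 t * b" for i
    \<comment> \<open>Freezing the entries at \<open>t\<close> costs \<open>2 * (C + 1)\<close>,
      replacing \<open>u\<close> and \<open>v\<close> by multiples of \<open>w\<close> another
      \<open>2 * C\<close>, both in units of \<open>\<delta> * n\<close>.\<close>
    have row: "norm (E B (row i x y) - scaleK (e i) w) \<le> (4 * C + 2) * (\<delta> * n)" if i: "i < 2" for i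
    proof -
      have fs: "f i 0 t \<in> scalars TYPE('a)" "f i 1 t \<in> scalars TYPE('a)"
        and fC: "norm (f i 0 t) \<le> C" "norm (f i 1 t) \<le> C"
        using entry_scalars bd(4) i tN tS by auto
      have "norm (E B (row i x y) - (scaleK (f i 0 t) u + scaleK (f i 1 t) v)) \<le> \<delta> * (norm u + norm v)"
        unfolding u_def v_def using x B t i \<delta> osc' by (intro norm_E_row_diff_le) auto
      also have "\<dots> \<le> \<delta> * (2 * (C + 1) * n)"
        using un vn \<delta> by (intro mult_left_mono) (simp_all add: algebra_simps)
      finally have 1: "norm (E B (row i x y) - (scaleK (f i 0 t) u + scaleK (f i 1 t) v)) \<le>
        \<delta> * (2 * (C + 1) * n)" .
      have "scaleK (e i) w = scaleK (f i 0 t) (scaleK a w) + scaleK (f i 1 t) (scaleK b w)"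
        using fs ab by (simp add: e_def scaleK_add_left scaleK_scaleK scalars_mult)
      then have "scaleK (f i 0 t) u + scaleK (f i 1 t) v - scaleK (e i) w =
          scaleK (f i 0 t) (u - scaleK a w) + scaleK (f i 1 t) (v - scaleK b w)"
        using fs by (simp add: scaleK_diff_right)
      also have "norm \<dots> \<le> C * (\<delta> * n) + C * (\<delta> * n)"
        using fs fC uw vw bd(1)
        by (intro order_trans[OF norm_triangle_ineq] add_mono) (auto simp: norm_scaleK intro!: mult_mono)
      finally have 2: "norm (scaleK (f i 0 t) u + scaleK (f i 1 t) v - scaleK (e i) w) \<le>
        C * (\<delta> * n) + C * (\<delta> * n)" .
      show ?thesis
        using norm_triangle_le[OF add_mono[OF 1 2]] by (simp add: algebra_simps)
    qed
    define X where "X = (E B (row 0 x y), E B (row 1 x y))"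
    define Y where "Y = (scaleK (e 0) w, scaleK (e 1) w)"
    define r where "r = norm (u, v)"
    have es: "e 0 \<in> scalars TYPE('a)" "e 1 \<in> scalars TYPE('a)"
      unfolding e_def using entry_scalars tN ab by (auto intro!: scalars_add scalars_mult)
    have XY: "norm (X - Y) \<le> (8 * C + 4) * (\<delta> * n)"
      using norm_Pair_le_add[of "E B (row 0 x y) - scaleK (e 0) w" "E B (row 1 x y) - scaleK (e 1) w"]
        row[of 0] row[of 1]
      by (simp add: X_def Y_def algebra_simps)
    have "(sqrt c * norm (scaleK a w, scaleK b w))\<^sup>2 = c * ((norm a)\<^sup>2 + (norm b)\<^sup>2) * n\<^sup>2"
      using ab c by (simp add: power_mult_distrib norm_Pair_power2 norm_scaleK n_def algebra_simps)
    also have "\<dots> \<le> ((norm (e 0))\<^sup>2 + (norm (e 1))\<^sup>2) * n\<^sup>2"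
      using ge[OF tS] by (intro mult_right_mono) (auto simp: e_def a_def b_def)
    also have "\<dots> = (norm Y)\<^sup>2"
      using es by (simp add: Y_def power_mult_distrib norm_Pair_power2 norm_scaleK n_def algebra_simps)
    finally have Y: "sqrt c * norm (scaleK a w, scaleK b w) \<le> norm Y"
      by (rule power2_le_imp_le) simp
    have "r \<le> norm (scaleK a w, scaleK b w) + norm ((u, v) - (scaleK a w, scaleK b w))"
      unfolding r_def by (metis add.commute diff_add_cancel norm_triangle_ineq)
    also have "norm ((u, v) - (scaleK a w, scaleK b w)) \<le> 2 * (\<delta> * n)"
      using norm_Pair_le_add[of "u - scaleK a w" "v - scaleK b w"] uw vw by simp
    finally have "sqrt c * r \<le> sqrt c * (norm (scaleK a w, scaleK b w) + 2 * (\<delta> * n))"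
      using c by (intro mult_left_mono) auto
    also have "\<dots> \<le> norm Y + 2 * sqrt c * (\<delta> * n)"
      using Y by (simp add: algebra_simps)
    also have "norm Y \<le> norm X + (8 * C + 4) * (\<delta> * n)"
      using XY norm_triangle_ineq[of X "Y - X"] by (simp add: norm_minus_commute)
    finally have lower: "sqrt c * r - L * (\<delta> * n) \<le> norm X"
      by (simp add: L_def algebra_simps)
    have rn: "r \<le> 2 * (C + 1) * n"
      unfolding r_def using norm_Pair_le_add[of u v] un vn by (simp add: algebra_simps)
    have r0: "0 \<le> r" by (simp add: r_def)
    \<comment> \<open>Squaring \<open>lower\<close> is legitimate only if its left side is
      nonnegative; otherwise the lower bound claimed here is itself at most 0.\<close>
    have "c * r\<^sup>2 - 2 * (sqrt c * r) * (L * (\<delta> * n)) \<le> (norm X)\<^sup>2"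
    proof (cases "L * (\<delta> * n) \<le> sqrt c * r")
      case True
      have "c * r\<^sup>2 - 2 * (sqrt c * r) * (L * (\<delta> * n)) \<le> (sqrt c * r - L * (\<delta> * n))\<^sup>2"
        using c by (simp add: power2_diff power_mult_distrib)
      also have "\<dots> \<le> (norm X)\<^sup>2"
        using True lower by (intro power_mono) auto
      finally show ?thesis .
    next
      case False
      have "c * r\<^sup>2 = (sqrt c * r) * (sqrt c * r)"
        using c by (simp add: power2_eq_square mult_ac)
      also have "\<dots> \<le> (sqrt c * r) * (L * (\<delta> * n))"
        using False c r0 by (intro mult_left_mono) auto
      also have "\<dots> \<le> 2 * (sqrt c * r) * (L * (\<delta> * n))"
        using c r0 L \<delta> n by simp
      finally show ?thesis by (smt (verit) zero_le_power2)
    qed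
    moreover have "2 * (sqrt c * r) * (L * (\<delta> * n)) \<le> 2 * (sqrt c * (2 * (C + 1) * n)) * (L * (\<delta> * n))"
      using rn c L \<delta> n by (intro mult_right_mono mult_left_mono) auto
    moreover have "2 * (sqrt c * (2 * (C + 1) * n)) * (L * (\<delta> * n)) = 4 * sqrt c * (C + 1) * L * \<delta> * n\<^sup>2"
      by (simp add: power2_eq_square mult_ac)
    ultimately have "c * r\<^sup>2 - 4 * sqrt c * (C + 1) * L * \<delta> * n\<^sup>2 \<le> (norm X)\<^sup>2" by linarith
    then show "- (4 * sqrt c * (C + 1) * L * \<delta> * \<mu> B) \<le> \<nu> B"
      by (simp add: \<nu>_def \<mu>_def X_def r_def n_def w_def norm_Pair_power2 u_def v_def)
  qed
  then show ?thesis by (simp add: \<nu>_def)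
qed

end

section \<open>Vectors on which the block is large\<close>

context block begin

text \<open>
  On \<open>S\<close> either \<open>(1, 0)\<close> is a maximal vector of the matrix \<open>f\<close>, or
  \<open>(cnj \<gamma> / (\<psi> / 2 - g), 1)\<close> is, with \<open>g = gram00 f\<close> and \<open>\<gamma> = gram01 f\<close>; passing to a non-null subset
  where this vector field is bounded makes the functional calculus applicable to it.
\<close>

lemma ex_bounded_maximal_field:
  assumes S: "S \<in> sets N" "\<not> null S"
  obtains T u0 u1 n where "T \<in> sets N" "T \<subseteq> S" "\<not> null T"
    "u0 \<in> borel_measurable N" "u1 \<in> borel_measurable N"
    "\<forall>t\<in>space N. u0 t \<in> scalars TYPE('a) \<and> u1 t \<in> scalars TYPE('a)"
    "\<forall>t\<in>T. norm (u0 t) \<le> real n \<and> norm (u1 t) \<le> real n"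
    "(\<forall>t\<in>T. u0 t = 1) \<or> (\<forall>t\<in>T. u1 t = 1)"
    "\<forall>t\<in>T. (norm (f 0 0 t * u0 t + f 0 1 t * u1 t))\<^sup>2 +
      (norm (f 1 0 t * u0 t + f 1 1 t * u1 t))\<^sup>2 = psi f t / 2 * ((norm (u0 t))\<^sup>2 + (norm (u1 t))\<^sup>2)"
proof -
  have SN: "S \<subseteq> space N" using S by (intro sets.sets_into_space)
  define Z where "Z = {t \<in> space N. gram00 f t = psi f t / 2}"
  have Z: "Z \<in> sets N" unfolding Z_def by (intro borel_measurable_eq) measurable
  show ?thesis
  proof (cases "null (S \<inter> Z)")
    \<comment> \<open>On \<open>Z\<close> column 0 alone has squared norm
      \<open>psi f t / 2\<close>, so the first basis vector is maximal there.\<close>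
    case False
    show ?thesis
    proof (rule that[of "S \<inter> Z" "\<lambda>_. 1" "\<lambda>_. 0" 1])
      have "gram00 f t = psi f t / 2" if "t \<in> S \<inter> Z" for t
        using that by (simp add: Z_def)
      then show "\<forall>t\<in>S \<inter> Z. (norm (f 0 0 t * 1 + f 0 1 t * 0))\<^sup>2 + (norm (f 1 0 t * 1 + f 1 1 t * 0))\<^sup>2 =
          psi f t / 2 * ((norm (1::complex))\<^sup>2 + (norm (0::complex))\<^sup>2)"
        by (simp add: gram00_def)
    qed (use S Z False in auto)
  next
    case True
    define u where "u t = cnj (gram01 f t) / of_real (psi f t / 2 - gram00 f t)" for t
    have [measurable]: "(\<lambda>t. cnj (gram01 f t)) \<in> borel_measurable N"
      by (rule measurable_compose[OF gram01_measurable])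
        (intro borel_measurable_continuous_onI continuous_on_cnj continuous_on_id)
    have u [measurable]: "u \<in> borel_measurable N"
      unfolding u_def by measurable
    have us: "u t \<in> scalars TYPE('a)" if "t \<in> space N" for t
    proof -
      have "gram01 f t \<in> scalars TYPE('a)"
        unfolding gram01_def using entry_scalars that by (auto intro!: scalars_add scalars_mult scalars_cnj)
      then show ?thesis
        unfolding u_def by (intro scalars_divide scalars_cnj scalars_of_real)
    qed
    define T where "T n = (S - Z) \<inter> {t \<in> space N. norm (u t) \<le> real n}" for n
    have "{t \<in> space N. norm (u t) \<le> real n} \<in> sets N" for n
      by measurable
    then have T: "T n \<in> sets N" for n
      unfolding T_def using S Z by (intro sets.Int sets.Diff)
    \<comment> \<open>The sets \<open>T n\<close> exhaust \<open>S - Z\<close>. If all were null, so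
      would be \<open>S\<close>, because \<open>S \<inter> Z\<close> is null in this case.\<close>
    have "\<exists>n. \<not> null (T n)"
    proof (rule ccontr)
      assume "\<not> (\<exists>n. \<not> null (T n))"
      then have "null (\<Union>n. T n)"
        using T by (intro null_countable_UN) auto
      moreover have "(\<Union>n. T n) = S - Z"
      proof
        show "S - Z \<subseteq> (\<Union>n. T n)"
        proof
          fix t assume t: "t \<in> S - Z"
          obtain n where "norm (u t) \<le> real n" using real_arch_simple by blast
          then show "t \<in> (\<Union>n. T n)" using t SN by (auto simp: T_def)
        qed
      qed (auto simp: T_def)
      ultimately have "null ((S \<inter> Z) \<union> (S - Z))"
        using S Z True by (intro null_Un) auto
      then show False using S by (simp add: Un_Diff_Int Int_Un_distrib Un_commute)
    qed
    then obtain n where n: "\<not> null (T n)" by blast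
    show ?thesis
    \<comment> \<open>\<open>Suc n\<close> in place of \<open>n\<close> lets the constant component
      1 obey the bound too.\<close>
    proof (rule that[of "T n" u "\<lambda>_. 1" "Suc n"])
      have "gram00 f t \<noteq> psi f t / 2" if "t \<in> T n" for t
        using that by (auto simp: T_def Z_def)
      then show "\<forall>t\<in>T n. (norm (f 0 0 t * u t + f 0 1 t * 1))\<^sup>2 + (norm (f 1 0 t * u t + f 1 1 t * 1))\<^sup>2 =
          psi f t / 2 * ((norm (u t))\<^sup>2 + (norm (1::complex))\<^sup>2)"
        using matrix_singular_vector[of f] by (simp add: u_def)
    qed (use T n us u in \<open>auto simp: T_def\<close>)
  qed
qed

text \<open>The maximal field is applied to some \<open>z\<close> with \<open>E T z\<close> nonzero,
  and the result is normalized. The component that is constantly 1 on \<open>T\<close> keeps it from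
  vanishing.\<close>

lemma ex_block_ge:
  assumes S: "S \<in> sets N" "\<not> null S" and c: "0 \<le> c" "\<And>t. t \<in> S \<Longrightarrow> c \<le> psi f t / 2"
  obtains x y where "x \<in> V" "y \<in> V" "(norm x)\<^sup>2 + (norm y)\<^sup>2 = 1"
    "c \<le> (norm (row 0 x y))\<^sup>2 + (norm (row 1 x y))\<^sup>2"
proof -
  obtain T u0 u1 n where T: "T \<in> sets N" "T \<subseteq> S" "\<not> null T"
    and um: "u0 \<in> borel_measurable N" "u1 \<in> borel_measurable N"
    and us: "\<forall>t\<in>space N. u0 t \<in> scalars TYPE('a) \<and> u1 t \<in> scalars TYPE('a)"
    and un: "\<forall>t\<in>T. norm (u0 t) \<le> real n \<and> norm (u1 t) \<le> real n"
    and u1: "(\<forall>t\<in>T. u0 t = 1) \<or> (\<forall>t\<in>T. u1 t = 1)"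
    and ueq: "\<forall>t\<in>T. (norm (f 0 0 t * u0 t + f 0 1 t * u1 t))\<^sup>2 +
      (norm (f 1 0 t * u0 t + f 1 1 t * u1 t))\<^sup>2 = psi f t / 2 * ((norm (u0 t))\<^sup>2 + (norm (u1 t))\<^sup>2)"
    using ex_bounded_maximal_field[OF S] by blast
  \<comment> \<open>Cutting off outside \<open>T\<close> makes the pointwise inequality trivial
    there, so \<open>norm_E_block_ge\<close> can be used on a co-null set, where it yields full
    norms.\<close>
  define v0 v1 where "v0 t = (if t \<in> T then u0 t else 0)" and "v1 t = (if t \<in> T then u1 t else 0)" for t
  have bd: "norm (v0 t) \<le> real n" "norm (v1 t) \<le> real n" for t
    using un by (auto simp: v0_def v1_def)
  have v: "v0 \<in> L_infinity V N E" "v1 \<in> L_infinity V N E"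
  proof -
    have "{t \<in> space N. real n < norm (v0 t)} = {}" "{t \<in> space N. real n < norm (v1 t)} = {}"
      using bd by (auto simp: not_less)
    then have "null {t \<in> space N. real n < norm (v0 t)}" "null {t \<in> space N. real n < norm (v1 t)}"
      by (simp_all only: null_empty)
    moreover have "v0 \<in> borel_measurable N" "v1 \<in> borel_measurable N"
      unfolding v0_def[abs_def] v1_def[abs_def] using um T by (auto intro!: measurable_If_set)
    moreover have "v0 ` space N \<subseteq> scalars TYPE('a)" "v1 ` space N \<subseteq> scalars TYPE('a)"
      using us by (auto simp: v0_def v1_def)
    ultimately show "v0 \<in> L_infinity V N E" "v1 \<in> L_infinity V N E"
      unfolding L_infinity_def by blast+
  qed
  obtain z where z: "z \<in> V" "E T z \<noteq> 0" using T(3) by (auto simp: spectral_null_def)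
  define x y where "x = calc v0 z" and "y = calc v1 z"
  have xy: "x \<in> V" "y \<in> V" using v z by (auto simp: x_def y_def intro: spectral_integral_in)
  have nz: "x \<noteq> 0 \<or> y \<noteq> 0"
  proof -
    \<comment> \<open>With oscillation bound 0 the local estimate becomes an equality.\<close>
    have "E T (calc g z) = E T z" if "\<forall>t\<in>T. g t = 1" "g \<in> L_infinity V N E" for g
      using norm_E_spectral_integral_diff_le[OF that(2) z(1) T(1) scalars_1, of 0] that(1) by simp
    then have "E T x = E T z \<or> E T y = E T z"
      using u1 v by (auto simp: x_def y_def v0_def v1_def)
    then show ?thesis using z T by auto
  qed
  obtain B C where B: "B \<in> sets N" "null (space N - B)" "0 \<le> C"
    "\<And>i j t. i < 2 \<Longrightarrow> j < 2 \<Longrightarrow> t \<in> B \<Longrightarrow> norm (f i j t) \<le> C"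
    using ex_essentially_bounded by blast
  have "c * ((norm (E B x))\<^sup>2 + (norm (E B y))\<^sup>2) \<le>
    (norm (E B (row 0 x y)))\<^sup>2 + (norm (E B (row 1 x y)))\<^sup>2"
    unfolding x_def y_def
  proof (rule norm_E_block_ge[OF B(1) z(1) c(1) v, of "max C (real n)"])
    fix t assume "t \<in> B"
    show "c * ((norm (v0 t))\<^sup>2 + (norm (v1 t))\<^sup>2) \<le>
      (norm (f 0 0 t * v0 t + f 0 1 t * v1 t))\<^sup>2 + (norm (f 1 0 t * v0 t + f 1 1 t * v1 t))\<^sup>2"
    proof (cases "t \<in> T")
      case True
      have "c * ((norm (u0 t))\<^sup>2 + (norm (u1 t))\<^sup>2) \<le> psi f t / 2 * ((norm (u0 t))\<^sup>2 + (norm (u1 t))\<^sup>2)"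
        using c(2) T(2) True by (intro mult_right_mono) auto
      also have "\<dots> = (norm (f 0 0 t * u0 t + f 0 1 t * u1 t))\<^sup>2 + (norm (f 1 0 t * u0 t + f 1 1 t * u1 t))\<^sup>2"
        using ueq True by simp
      finally show ?thesis using True by (simp add: v0_def v1_def)
    qed (simp add: v0_def v1_def)
  qed (use B bd in \<open>auto intro: le_max_iff_disj[THEN iffD2]\<close>)
  then have ge: "c * ((norm x)\<^sup>2 + (norm y)\<^sup>2) \<le> (norm (row 0 x y))\<^sup>2 + (norm (row 1 x y))\<^sup>2"
    using xy row_in[of _ x y] B by (simp add: E_compl_null)
  define r where "r = norm (x, y)"
  have r: "r > 0" "(norm x)\<^sup>2 + (norm y)\<^sup>2 = r\<^sup>2"
    using nz by (auto simp: r_def norm_Pair_power2 zero_prod_def)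
  let ?x = "(1 / r) *\<^sub>R x" and ?y = "(1 / r) *\<^sub>R y"
  show ?thesis
  proof (rule that[of ?x ?y])
    show "?x \<in> V" "?y \<in> V" using xy by (auto intro: closed_subspace_scaleR[OF subspace])
    show "(norm ?x)\<^sup>2 + (norm ?y)\<^sup>2 = 1"
      using r by (simp add: power_mult_distrib power_divide add_divide_distrib[symmetric])
    have "(norm (row 0 ?x ?y))\<^sup>2 + (norm (row 1 ?x ?y))\<^sup>2 =
        ((norm (row 0 x y))\<^sup>2 + (norm (row 1 x y))\<^sup>2) / r\<^sup>2"
      using xy r by (simp add: row_scaleR power_mult_distrib power_divide add_divide_distrib)
    then show "c \<le> (norm (row 0 ?x ?y))\<^sup>2 + (norm (row 1 ?x ?y))\<^sup>2"
      using ge r by (simp add: pos_le_divide_eq)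
  qed
qed

section \<open>The block at its critical level: \<open>lam\<close> and \<open>Sig\<close> are
  \<open>lambda_max\<close> and \<open>Sigma_max\<close> inside the locale\<close>

definition lam :: real where
  "lam = ess_sup V N E (\<lambda>t. psi f t / 2)"

definition Sig :: "real set" where
  "Sig = {t \<in> space N. psi f t = ess_sup V N E (psi f)}"

lemma half_psi_measurable: "(\<lambda>t. psi f t / 2) \<in> borel_measurable N"
  by measurable

lemma half_psi_essentially_bounded: "\<exists>C. null {t \<in> space N. C < psi f t / 2}"
proof -
  obtain C where "null {t \<in> space N. C < psi f t}" using psi_essentially_bounded by blast
  then have "null {t \<in> space N. C / 2 < psi f t / 2}" by simp
  then show ?thesis by blast
qed

lemma lam_nonneg: "0 \<le> lam"
  and null_above_lam: "null {t \<in> space N. lam < psi f t / 2}"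
  using half_psi_essentially_bounded ess_sup_nonneg[OF _ half_psi_measurable]
    null_above_ess_sup[OF _ half_psi_measurable]
  by (auto simp: lam_def)

lemma Sig_eq: "Sig = {t \<in> space N. psi f t / 2 = lam}"
proof -
  have "ess_sup V N E (psi f) = 2 * lam"
    unfolding lam_def using psi_essentially_bounded ess_sup_half[OF _ psi_measurable] by auto
  then show ?thesis by (auto simp: Sig_def)
qed

lemma Sig_measurable: "Sig \<in> sets N"
  unfolding Sig_eq by (intro borel_measurable_eq) measurable

lemma norm_block_le:
  assumes x: "x \<in> V" "y \<in> V"
  shows "(norm (row 0 x y))\<^sup>2 + (norm (row 1 x y))\<^sup>2 \<le> lam * ((norm x)\<^sup>2 + (norm y)\<^sup>2)"
proof -
  let ?S = "{t \<in> space N. psi f t / 2 \<le> lam}"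
  have S: "?S \<in> sets N" by measurable
  have "space N - ?S = {t \<in> space N. lam < psi f t / 2}" by auto
  then have "null (space N - ?S)" using null_above_lam by simp
  then show ?thesis
    using norm_E_block_le[OF S lam_nonneg _ x] x row_in[of _ x y] S by (simp add: E_compl_null)
qed

lemma norm_block_less:
  assumes Sig: "null Sig" and x: "x \<in> V" "y \<in> V" "x \<noteq> 0 \<or> y \<noteq> 0"
  shows "(norm (row 0 x y))\<^sup>2 + (norm (row 1 x y))\<^sup>2 < lam * ((norm x)\<^sup>2 + (norm y)\<^sup>2)"
proof -
  define S where "S n = {t \<in> space N. psi f t / 2 \<le> lam - 1 / Suc n}" for n
  have S: "S n \<in> sets N" for n unfolding S_def by measurable
  \<comment> \<open>Up to a null set the complement of the union of the \<open>S n\<close> lies in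
    \<open>Sig\<close>. If every \<open>E (S n)\<close> killed both vectors, then so would the
    projection of a co-null set, forcing \<open>x = y = 0\<close>.\<close>
  have "\<exists>n. E (S n) x \<noteq> 0 \<or> E (S n) y \<noteq> 0"
  proof (rule ccontr)
    assume "\<not> ?thesis"
    then have "E (\<Union>n. S n) x = 0" "E (\<Union>n. S n) y = 0"
      using S x by (auto intro!: E_countable_UN_zero)
    moreover have U: "(\<Union>n. S n) \<in> sets N" using S by auto
    moreover have "null (space N - (\<Union>n. S n))"
    proof -
      have sub: "space N - (\<Union>n. S n) \<subseteq> Sig \<union> {t \<in> space N. lam < psi f t / 2}"
      proof
        fix t assume "t \<in> space N - (\<Union>n. S n)"
        then have t: "t \<in> space N" "\<And>n. t \<notin> S n" by auto
        have "lam \<le> psi f t / 2"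
        proof (rule ccontr)
          assume "\<not> lam \<le> psi f t / 2"
          then obtain n where "1 / Suc n < lam - psi f t / 2"
            using nat_approx_posE[of "lam - psi f t / 2"] by auto
          then have "t \<in> S n" using t(1) by (simp add: S_def)
          then show False using t(2) by blast
        qed
        then show "t \<in> Sig \<union> {t \<in> space N. lam < psi f t / 2}"
          using t(1) by (auto simp: Sig_eq)
      qed
      have above: "{t \<in> space N. lam < psi f t / 2} \<in> sets N" by measurable
      show ?thesis
        using U by (intro null_subset[OF null_Un[OF Sig_measurable above Sig null_above_lam] _ _ sub]
            sets.Un Sig_measurable above) auto
    qed
    ultimately show False using x by (simp add: E_compl_null)
  qed
  then obtain n where n: "E (S n) x \<noteq> 0 \<or> E (S n) y \<noteq> 0" by blast
  define a where "a = (norm (E (S n) x))\<^sup>2 + (norm (E (S n) y))\<^sup>2"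
  \<comment> \<open>\<open>R\<close> and \<open>S n\<close> partition a co-null set: the constant
    \<open>lam\<close> serves on \<open>R\<close>, a strictly smaller one on \<open>S n\<close>,
    where \<open>(x, y)\<close> has a nonzero part.\<close>
  define R where "R = {t \<in> space N. psi f t / 2 \<le> lam} - S n"
  define b where "b = (norm (E R x))\<^sup>2 + (norm (E R y))\<^sup>2"
  have a: "a > 0"
    using n by (auto simp: a_def add_pos_nonneg add_nonneg_pos)
  have R: "R \<in> sets N" unfolding R_def using S by (intro sets.Diff) measurable
  have RS: "R \<union> S n \<in> sets N" "R \<inter> S n = {}"
    using R S by (auto simp: R_def)
  have "space N - (R \<union> S n) = {t \<in> space N. lam < psi f t / 2}"
  proof -
    have "S n \<subseteq> {t \<in> space N. psi f t / 2 \<le> lam}"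
    proof
      fix t assume "t \<in> S n"
      then have "t \<in> space N" "psi f t / 2 \<le> lam - 1 / Suc n" by (auto simp: S_def)
      moreover have "0 < 1 / real (Suc n)" by simp
      ultimately have "t \<in> space N" "psi f t / 2 \<le> lam" by linarith+
      then show "t \<in> {t \<in> space N. psi f t / 2 \<le> lam}" by simp
    qed
    then show ?thesis unfolding R_def by auto
  qed
  then have "null (space N - (R \<union> S n))" using null_above_lam by simp
  then have split: "(norm z)\<^sup>2 = (norm (E R z))\<^sup>2 + (norm (E (S n) z))\<^sup>2" if "z \<in> V" for z
    using additive_onD[OF additive_on_norm_E[OF that] R S RS(2)] E_compl_null[OF RS(1) _ that] by simp
  have r: "row 0 x y \<in> V" "row 1 x y \<in> V" using x by (auto intro: row_in)
  have 1: "(norm (E R (row 0 x y)))\<^sup>2 + (norm (E R (row 1 x y)))\<^sup>2 \<le> lam * b"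
    unfolding b_def using R lam_nonneg x by (intro norm_E_block_le) (auto simp: R_def)
  have "(norm (E (S n) (row 0 x y)))\<^sup>2 + (norm (E (S n) (row 1 x y)))\<^sup>2 < lam * a"
  proof -
    \<comment> \<open>A point of \<open>S n\<close> together with \<open>psi_nonneg\<close> gives
      \<open>0 \<le> lam - 1 / Suc n\<close>, the sign condition of
      \<open>norm_E_block_le\<close>.\<close>
    have "S n \<noteq> {}" using n x by auto
    then obtain t where "t \<in> S n" by blast
    then have "psi f t / 2 \<le> lam - 1 / Suc n" by (simp add: S_def)
    then have c: "0 \<le> lam - 1 / Suc n"
      using psi_nonneg[of f t] by linarith
    then have "(norm (E (S n) (row 0 x y)))\<^sup>2 + (norm (E (S n) (row 1 x y)))\<^sup>2 \<le> (lam - 1 / Suc n) * a"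
      unfolding a_def using S x by (intro norm_E_block_le) (auto simp: S_def)
    also have "\<dots> < lam * a" using a by (intro mult_strict_right_mono) auto
    finally show ?thesis .
  qed
  with 1 show ?thesis
    unfolding split[OF r(1)] split[OF r(2)] split[OF x(1)] split[OF x(2)] a_def b_def
    by (simp add: distrib_left)
qed

lemma ex_block_eq_lam:
  assumes "\<not> null Sig"
  obtains x y where "x \<in> V" "y \<in> V" "(norm x)\<^sup>2 + (norm y)\<^sup>2 = 1"
    "(norm (row 0 x y))\<^sup>2 + (norm (row 1 x y))\<^sup>2 = lam"
proof -
  obtain x y where "x \<in> V" "y \<in> V" "(norm x)\<^sup>2 + (norm y)\<^sup>2 = 1"
    "lam \<le> (norm (row 0 x y))\<^sup>2 + (norm (row 1 x y))\<^sup>2"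
    using ex_block_ge[OF Sig_measurable assms lam_nonneg] by (auto simp: Sig_eq)
  then show ?thesis using norm_block_le[of x y] by (intro that[of x y]) auto
qed

lemma ex_block_ge_below_lam:
  assumes "0 \<le> c" "c < lam"
  obtains x y where "x \<in> V" "y \<in> V" "(norm x)\<^sup>2 + (norm y)\<^sup>2 = 1"
    "c \<le> (norm (row 0 x y))\<^sup>2 + (norm (row 1 x y))\<^sup>2"
proof -
  have "\<not> null {t \<in> space N. c < psi f t / 2}"
    using assms by (intro not_null_above) (simp_all add: lam_def)
  moreover have "{t \<in> space N. c < psi f t / 2} \<in> sets N" by measurable
  ultimately show ?thesis
    using ex_block_ge[of "{t \<in> space N. c < psi f t / 2}" c] assms that by auto
qed

end

section \<open>Norm attainment\<close>

text \<open>The estimate makes the quotients in \<open>onorm\<close> bounded above, so each is at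
  most the supremum; \<open>\<bar>b\<bar>\<close> also covers \<open>w = 0\<close>, whose quotient
  is 0.\<close>

lemma norm_le_onorm:
  fixes T :: "'a::real_normed_vector \<Rightarrow> 'b::real_normed_vector"
  assumes T: "\<And>v. norm (T v) \<le> b * norm v" and v: "norm v = 1"
  shows "norm (T v) \<le> onorm T"
proof -
  have "norm (T w) / norm w \<le> \<bar>b\<bar>" for w
  proof (cases "w = 0")
    case False
    then have "norm (T w) / norm w \<le> b" using T[of w] by (simp add: pos_divide_le_eq)
    then show ?thesis by simp
  qed simp
  then have "bdd_above (range (\<lambda>w. norm (T w) / norm w))" by (intro bdd_aboveI2)
  then have "norm (T v) / norm v \<le> onorm T"
    unfolding onorm_def by (rule cSUP_upper[OF UNIV_I])
  then show ?thesis using v by simp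
qed

lemma norm_le_sqrtI:
  assumes "(norm u)\<^sup>2 \<le> c * (norm v)\<^sup>2" "0 \<le> c"
  shows "norm u \<le> sqrt c * norm v"
  by (rule power2_le_imp_le) (use assms in \<open>simp_all add: power_mult_distrib\<close>)

lemma norm_attainingI:
  assumes T: "\<And>v. (norm (T v))\<^sup>2 \<le> c * (norm v)\<^sup>2" and v: "norm v = 1" "c \<le> (norm (T v))\<^sup>2" and c: "0 \<le> c"
  shows "norm_attaining T"
proof -
  have b: "norm (T w) \<le> sqrt c * norm w" for w by (rule norm_le_sqrtI[OF T c])
  have "onorm T \<le> sqrt c"
    using c by (intro onorm_bound b) simp
  moreover have "sqrt c \<le> norm (T v)" using v(2) by (intro real_le_lsqrt) auto
  moreover have "norm (T v) \<le> onorm T" using b v(1) by (rule norm_le_onorm)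
  ultimately show ?thesis using v(1) unfolding norm_attaining_def by force
qed

lemma sum_lessThan_2_2:
  "(\<Sum>i<2. \<Sum>j<2. g i j) = g 0 0 + g 0 1 + (g 1 0 + g (1::nat) (1::nat))"
  for g :: "nat \<Rightarrow> nat \<Rightarrow> 'b::comm_monoid_add"
  by (simp add: numeral_2_eq_2)

text \<open>Pythagoras for six mutually orthogonal summands; \<open>U\<close> preserves norms, so
  the last one contributes the norm of \<open>y\<close> itself.\<close>

lemma norm_assemble:
  fixes U :: "'a::hilbert \<Rightarrow> 'a"
  assumes dec: "orthogonal_decomposition D M U" and comp: "components D M d x y"
  shows "(norm (assemble U d x y))\<^sup>2 =
    (\<Sum>i<2. \<Sum>j<2. (norm (d i j))\<^sup>2) + (norm x)\<^sup>2 + (norm y)\<^sup>2"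
proof -
  have d: "d i j \<in> D i j" if "i < 2" "j < 2" for i j
    using comp that by (auto simp: components_def)
  have xy: "x \<in> M" "U y \<in> U ` M" "y \<in> M" using comp by (auto simp: components_def)
  have "inner (d i j) (d k l) = 0" if "i < 2" "j < 2" "k < 2" "l < 2" "(i, j) \<noteq> (k, l)" for i j k l
    using dec that d by (simp add: orthogonal_decomposition_def orthogonal_sets_def Re_kinner[symmetric])
  then have o: "inner (d 0 0) (d 0 1) = 0" "inner (d 0 0) (d 1 0) = 0" "inner (d 0 0) (d 1 1) = 0"
    "inner (d 0 1) (d 1 0) = 0" "inner (d 0 1) (d 1 1) = 0" "inner (d 1 0) (d 1 1) = 0"
    by simp_all
  have "inner (d i j) x = 0" "inner (d i j) (U y) = 0" if "i < 2" "j < 2" for i j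
    using dec that d xy
    by (simp_all add: orthogonal_decomposition_def orthogonal_sets_def Re_kinner[symmetric])
  then have o': "inner (d 0 0) x = 0" "inner (d 0 1) x = 0" "inner (d 1 0) x = 0" "inner (d 1 1) x = 0"
    "inner (d 0 0) (U y) = 0" "inner (d 0 1) (U y) = 0" "inner (d 1 0) (U y) = 0" "inner (d 1 1) (U y) = 0"
    by simp_all
  have "inner x (U y) = 0" "inner (U y) (U y) = inner y y"
    using dec xy
    by (simp_all add: orthogonal_decomposition_def orthogonal_sets_def unitary_between_def Re_kinner[symmetric])
  then show ?thesis
    using o o' unfolding assemble_def sum_lessThan_2_2
    by (simp add: power2_norm_eq_inner inner_add inner_commute)
qed

theorem theorem3:
  fixes P Q H U A :: "'a::hilbert \<Rightarrow> 'a"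
    and D :: "nat \<Rightarrow> nat \<Rightarrow> 'a set" and M :: "'a set"
    and E :: "real set \<Rightarrow> 'a \<Rightarrow> 'a"
    and a :: "nat \<Rightarrow> nat \<Rightarrow> complex"
    and f :: "nat \<Rightarrow> nat \<Rightarrow> real \<Rightarrow> complex"
  assumes "orthogonal_projection UNIV P" and "orthogonal_projection UNIV Q"
    and "halmos_decomposition P Q D M U H"
    and "spectral_measure M H E"
    and "\<And>i j. i < 2 \<Longrightarrow> j < 2 \<Longrightarrow> a i j \<in> scalars TYPE('a)"
    and "\<And>i j. i < 2 \<Longrightarrow> j < 2 \<Longrightarrow> f i j \<in> L_infinity M (spectrum_borel M H) E"
    and "block_operator D M U H E a f A"
  shows "norm_attaining A \<longleftrightarrow>
      a_max D a \<ge> ereal (sqrt (lambda_max M H E f)) \<or>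
      (a_max D a < ereal (sqrt (lambda_max M H E f)) \<and> \<not> spectral_null M E (Sigma_max M H E f))"
proof -
  have dec: "orthogonal_decomposition D M U"
    using assms(3) by (simp add: halmos_decomposition_def)
  have M: "closed_subspace M" and D: "\<And>i j. i < 2 \<Longrightarrow> j < 2 \<Longrightarrow> closed_subspace (D i j)"
    using dec by (auto simp: orthogonal_decomposition_def)
  interpret block M "spectrum_borel M H" E f
    using M assms(4,6) by unfold_locales (auto simp: spectral_measure_def)
  have lam: "lambda_max M H E f = lam" by (simp add: lambda_max_def lam_def)
  have Sig: "Sigma_max M H E f = Sig" by (simp add: Sigma_max_def Sig_def)
  have ex: "\<exists>d x y. components D M d x y \<and> v = assemble U d x y" for v
    using dec by (simp add: orthogonal_decomposition_def)
  have normA: "(norm (A (assemble U d x y)))\<^sup>2 =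
      (\<Sum>i<2. \<Sum>j<2. (norm (a i j))\<^sup>2 * (norm (d i j))\<^sup>2) + ((norm (row 0 x y))\<^sup>2 + (norm (row 1 x y))\<^sup>2)"
    if comp: "components D M d x y" for d x y
  proof -
    have xy: "x \<in> M" "y \<in> M" using comp by (auto simp: components_def)
    have "A (assemble U d x y) = assemble U (\<lambda>i j. scaleK (a i j) (d i j)) (row 0 x y) (row 1 x y)"
      using assms(7) comp by (simp add: block_operator_def row_def Let_def)
    moreover have "components D M (\<lambda>i j. scaleK (a i j) (d i j)) (row 0 x y) (row 1 x y)"
      using comp D assms(5) xy
      by (auto simp: components_def intro: row_in closed_subspace_scaleK)
    ultimately show ?thesis
      using assms(5) by (simp add: norm_assemble[OF dec] norm_scaleK power_mult_distrib)
  qed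
  \<comment> \<open>Coefficients \<open>a i j\<close> outside \<open>Lam D\<close> multiply only
    zero vectors, so no bound on them is required below.\<close>
  have zero: "d i j = 0" if "components D M d x y" "i < 2" "j < 2" "(i, j) \<notin> Lam D" for d x y i j
    using that by (auto simp: components_def Lam_def)
  have bound: "(norm (A v))\<^sup>2 \<le> c * (norm v)\<^sup>2"
    if c: "lam \<le> c" "\<And>i j. (i, j) \<in> Lam D \<Longrightarrow> (norm (a i j))\<^sup>2 \<le> c" for c v
  proof -
    obtain d x y where comp: "components D M d x y" and v: "v = assemble U d x y" using ex by blast
    have "(norm (a i j))\<^sup>2 * (norm (d i j))\<^sup>2 \<le> c * (norm (d i j))\<^sup>2" if "i < 2" "j < 2" for i j
      using zero[OF comp that] c(2)[of i j] by (cases "(i, j) \<in> Lam D") (auto intro: mult_right_mono)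
    then have "(\<Sum>i<2. \<Sum>j<2. (norm (a i j))\<^sup>2 * (norm (d i j))\<^sup>2) \<le> (\<Sum>i<2. \<Sum>j<2. c * (norm (d i j))\<^sup>2)"
      by (intro sum_mono) auto
    moreover have "(norm (row 0 x y))\<^sup>2 + (norm (row 1 x y))\<^sup>2 \<le> c * ((norm x)\<^sup>2 + (norm y)\<^sup>2)"
      using comp c(1)
      by (intro order_trans[OF norm_block_le] mult_right_mono) (auto simp: components_def)
    ultimately show ?thesis
      unfolding v normA[OF comp] norm_assemble[OF dec comp]
      by (simp add: sum_distrib_left distrib_left)
  qed
  have finite_Lam: "finite (Lam D)"
    by (rule finite_subset[of _ "{..<2} \<times> {..<2}"]) (auto simp: Lam_def)
  have embed: "components D M (\<lambda>i j. 0) x y" if "x \<in> M" "y \<in> M" for x y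
    using that D by (auto simp: components_def intro: closed_subspace_zero)
  show ?thesis
  proof (cases "ereal (sqrt lam) \<le> a_max D a")
    case True
    let ?g = "\<lambda>(j, k). ereal (norm (a j k))"
    \<comment> \<open>For empty \<open>Lam D\<close> the supremum is \<open>- \<infinity>\<close>,
      below \<open>sqrt lam\<close>. Hence \<open>a_max\<close> is a maximum over a nonempty finite
      set, attained by some \<open>a j k\<close>.\<close>
    have ne: "Lam D \<noteq> {}"
    proof
      assume "Lam D = {}"
      then have "a_max D a = - \<infinity>" by (simp add: a_max_def bot_ereal_def)
      then show False using True by simp
    qed
    then have "a_max D a = Max (?g ` Lam D)"
      unfolding a_max_def using finite_Lam by (simp add: Max_Sup)
    then have "a_max D a \<in> ?g ` Lam D"
      using finite_Lam ne by simp
    then obtain j k where jk: "(j, k) \<in> Lam D" and amax: "a_max D a = ereal (norm (a j k))"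
      by auto
    let ?b = "norm (a j k)"
    have le: "norm (a i l) \<le> ?b" if "(i, l) \<in> Lam D" for i l
    proof -
      have "?g (i, l) \<le> a_max D a" unfolding a_max_def by (rule SUP_upper[OF that])
      then show ?thesis by (simp add: amax)
    qed
    have "sqrt lam \<le> ?b" using True by (simp add: amax)
    then have "lam \<le> ?b\<^sup>2" by (simp add: sqrt_le_D)
    have jk2: "j < 2" "k < 2" using jk by (auto simp: Lam_def)
    have "0 \<in> D j k" using D jk2 by (auto intro: closed_subspace_zero)
    then obtain e where e: "e \<in> D j k" "e \<noteq> 0" using jk by (auto simp: Lam_def)
    define e' where "e' = (1 / norm e) *\<^sub>R e"
    have e': "e' \<in> D j k" "norm e' = 1"
      using e D jk2 by (auto simp: e'_def intro: closed_subspace_scaleR)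
    \<comment> \<open>The unit vector \<open>e'\<close> of the maximizing summand, which
      \<open>A\<close> multiplies by \<open>a j k\<close>; both \<open>lam\<close> and the other
      scalars of \<open>Lam D\<close> are dominated by this coefficient.\<close>
    define d where "d i l = (if i = j \<and> l = k then e' else 0)" for i l
    have comp: "components D M d 0 0"
      using e' D M by (auto simp: components_def d_def intro: closed_subspace_zero)
    have sum: "(\<Sum>i<2. \<Sum>l<2. c i l * (norm (d i l))\<^sup>2) = c j k" for c :: "nat \<Rightarrow> nat \<Rightarrow> real"
    proof -
      have "(\<Sum>i<2. \<Sum>l<2. c i l * (norm (d i l))\<^sup>2) = (\<Sum>i<2. \<Sum>l<2. if l = k then if i = j then c i l else 0 else 0)"
        using e' by (intro sum.cong refl) (auto simp: d_def)
      then show ?thesis using jk2 by simp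
    qed
    have "(norm (assemble U d 0 0))\<^sup>2 = 1"
      unfolding norm_assemble[OF dec comp] using sum[of "\<lambda>_ _. 1"] by simp
    then have "norm (assemble U d 0 0) = 1"
      by (simp add: power2_eq_1_iff) (smt (verit) norm_ge_zero)
    moreover have "?b\<^sup>2 \<le> (norm (A (assemble U d 0 0)))\<^sup>2"
      unfolding normA[OF comp] sum by simp
    moreover have "(norm (A v))\<^sup>2 \<le> ?b\<^sup>2 * (norm v)\<^sup>2" for v
      using \<open>lam \<le> ?b\<^sup>2\<close> le by (intro bound power_mono) auto
    ultimately have "norm_attaining A" by (intro norm_attainingI[of A "?b\<^sup>2"]) auto
    then show ?thesis using True by (simp add: lam)
  next
    case False
    have less: "(norm (a i j))\<^sup>2 < lam" if "(i, j) \<in> Lam D" for i j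
    proof -
      have "(\<lambda>(j, k). ereal (norm (a j k))) (i, j) \<le> a_max D a"
        unfolding a_max_def by (rule SUP_upper[OF that])
      also have "\<dots> < ereal (sqrt lam)" using False by simp
      finally have "norm (a i j) < sqrt lam" by simp
      then show ?thesis using real_less_rsqrt real_sqrt_less_iff[of "(norm (a i j))\<^sup>2" lam] by simp
    qed
    then have le: "(norm (A v))\<^sup>2 \<le> lam * (norm v)\<^sup>2" for v
      by (intro bound) (auto intro: less_imp_le)
    have unit: "norm (assemble U (\<lambda>i j. 0) x y) = 1"
      "(norm (A (assemble U (\<lambda>i j. 0) x y)))\<^sup>2 = (norm (row 0 x y))\<^sup>2 + (norm (row 1 x y))\<^sup>2"
      if "x \<in> M" "y \<in> M" "(norm x)\<^sup>2 + (norm y)\<^sup>2 = 1" for x y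
    proof -
      have "(norm (assemble U (\<lambda>i j. 0) x y))\<^sup>2 = 1"
        using that by (simp add: norm_assemble[OF dec embed])
      then show "norm (assemble U (\<lambda>i j. 0) x y) = 1"
        by (simp add: power2_eq_1_iff) (smt (verit) norm_ge_zero)
      show "(norm (A (assemble U (\<lambda>i j. 0) x y)))\<^sup>2 = (norm (row 0 x y))\<^sup>2 + (norm (row 1 x y))\<^sup>2"
        using that by (simp add: normA[OF embed])
    qed
    \<comment> \<open>All relevant scalars are now strictly below \<open>sqrt lam\<close>, so the
      first half of alternative (ii) holds and only the size of \<open>Sig\<close> decides.\<close>
    have "norm_attaining A \<longleftrightarrow> \<not> null Sig"
    proof
      assume "\<not> null Sig"
      then obtain x y where xy: "x \<in> M" "y \<in> M" "(norm x)\<^sup>2 + (norm y)\<^sup>2 = 1"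
        "(norm (row 0 x y))\<^sup>2 + (norm (row 1 x y))\<^sup>2 = lam"
        by (rule ex_block_eq_lam)
      then show "norm_attaining A"
        using unit[OF xy(1-3)] le lam_nonneg by (intro norm_attainingI[of A lam]) auto
    next
      assume "norm_attaining A"
      then obtain v where v: "norm v = 1" "norm (A v) = onorm A" by (auto simp: norm_attaining_def)
      show "\<not> null Sig"
      proof
        assume null: "null Sig"
        obtain d x y where comp: "components D M d x y" and v': "v = assemble U d x y" using ex by blast
        have xy: "x \<in> M" "y \<in> M" using comp by (auto simp: components_def)
        let ?d = "\<Sum>i<2. \<Sum>j<2. (norm (a i j))\<^sup>2 * (norm (d i j))\<^sup>2"
        let ?n = "\<Sum>i<2. \<Sum>j<2. (norm (d i j))\<^sup>2"
        have term_le: "(norm (a i j))\<^sup>2 * (norm (d i j))\<^sup>2 \<le> lam * (norm (d i j))\<^sup>2" if "i < 2" "j < 2" for i j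
          using zero[OF comp that] less[of i j]
          by (cases "(i, j) \<in> Lam D") (auto intro: mult_right_mono less_imp_le)
        have d_le: "?d \<le> lam * ?n"
          unfolding sum_distrib_left by (intro sum_mono term_le) auto
        have r_le: "(norm (row 0 x y))\<^sup>2 + (norm (row 1 x y))\<^sup>2 \<le> lam * ((norm x)\<^sup>2 + (norm y)\<^sup>2)"
          by (rule norm_block_le[OF xy])
        have n1: "?n + ((norm x)\<^sup>2 + (norm y)\<^sup>2) = 1"
          using v(1) norm_assemble[OF dec comp] by (simp add: v')
        \<comment> \<open>Strictness comes from the block when \<open>(x, y)\<close> is nonzero.
          Otherwise some \<open>d i j\<close> is nonzero, its index lies in \<open>Lam D\<close>,
          and its coefficient is strictly below \<open>sqrt lam\<close>.\<close>
        have "?d + ((norm (row 0 x y))\<^sup>2 + (norm (row 1 x y))\<^sup>2) < lam * ?n + lam * ((norm x)\<^sup>2 + (norm y)\<^sup>2)"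
        proof (cases "x = 0 \<and> y = 0")
          case False
          then show ?thesis using d_le norm_block_less[OF null xy] by (intro add_le_less_mono) auto
        next
          case True
          then have "?n \<noteq> 0" using n1 by simp
          then obtain i j where ij: "i < 2" "j < 2" "d i j \<noteq> 0"
            by (auto elim!: sum.not_neutral_contains_not_neutral)
          then have "(i, j) \<in> Lam D" using zero[OF comp] by blast
          then have strict: "(norm (a i j))\<^sup>2 * (norm (d i j))\<^sup>2 < lam * (norm (d i j))\<^sup>2"
            using less ij by (intro mult_strict_right_mono) auto
          have row_less: "(\<Sum>l<2. (norm (a i l))\<^sup>2 * (norm (d i l))\<^sup>2) < (\<Sum>l<2. lam * (norm (d i l))\<^sup>2)"
            by (intro sum_strict_mono_ex1 ballI bexI[of _ j] term_le strict) (use ij in auto)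
          have row_le: "(\<Sum>l<2. (norm (a k l))\<^sup>2 * (norm (d k l))\<^sup>2) \<le> (\<Sum>l<2. lam * (norm (d k l))\<^sup>2)"
            if "k < 2" for k
            using term_le that by (intro sum_mono) auto
          have "?d < lam * ?n"
            unfolding sum_distrib_left
          proof (rule sum_strict_mono_ex1)
            show "\<exists>k\<in>{..<2}. (\<Sum>l<2. (norm (a k l))\<^sup>2 * (norm (d k l))\<^sup>2) < (\<Sum>l<2. lam * (norm (d k l))\<^sup>2)"
              by (intro bexI[of _ i] row_less) (use ij in simp)
          qed (use row_le in auto)
          then show ?thesis using r_le by (rule add_less_le_mono)
        qed
        then have "(norm (A v))\<^sup>2 < lam"
          unfolding v' normA[OF comp] using n1 by (simp add: distrib_left[symmetric])
        \<comment> \<open>Unit vectors of the last two summands come arbitrarily close to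
          \<open>lam\<close> in squared image norm, so some \<open>w\<close> exceeds the level
          \<open>c\<close> chosen above \<open>v\<close>, contradicting
          \<open>norm (A v) = onorm A\<close>.\<close>
        then obtain c where c: "(norm (A v))\<^sup>2 < c" "c < lam" using dense by blast
        then have "0 \<le> c" by (smt (verit) zero_le_power2)
        then obtain x' y' where x': "x' \<in> M" "y' \<in> M" "(norm x')\<^sup>2 + (norm y')\<^sup>2 = 1"
          "c \<le> (norm (row 0 x' y'))\<^sup>2 + (norm (row 1 x' y'))\<^sup>2"
          using ex_block_ge_below_lam c(2) by blast
        define w where "w = assemble U (\<lambda>i j. 0) x' y'"
        have "(norm (A v))\<^sup>2 < (norm (A w))\<^sup>2"
          using unit(2)[OF x'(1-3)] x'(4) c(1) by (simp add: w_def)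
        then have "norm (A v) < norm (A w)" by (rule power2_less_imp_less) simp
        moreover have "norm (A w) \<le> onorm A"
          using norm_le_sqrtI[OF le lam_nonneg] unit(1)[OF x'(1-3)] unfolding w_def by (rule norm_le_onorm)
        ultimately show False using v(2) by simp
      qed
    qed
    then show ?thesis using False unfolding lam Sig by (metis not_le)
  qed
qed

end
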